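(* For every $C^2$ solution $R$ of $R_{xx}-R_{tt}=0$, if $m_0(0)<2R_0/3$, then $R(t,x)>0$ for all $t\ge 0$, $x\in\mathbb{R}$. Moreover, $$\|R-R_b\|_\infty(t)\le (t+1)\,m_0(0)\quad\text{for } t\ge 0,$$ and for every multi-index $\alpha\ne(0,0)$ there is a constant $C$ such that, for $t\ge 0$ and $x\in\mathbb{R}$: (i) if $R$ is a $C^{|\alpha|}$ solution, then $$\|\partial^\alpha(R-R_b)\|_\infty(t)\le m_{|\alpha|}(0);$$ (ii) if $R$ is a $C^{|\alpha|+1}$ solution, then $$\left|\partial^\alpha\left(\frac{R_t}{R}-\frac{\partial_tR_b}{R_b}\right)\right|(t,x),\ \left|\partial^\alpha\left(\frac{R_x}{R}-\frac{\partial_xR_b}{R_b}\right)\right|(t,x)\le C\,\frac{t+1}{e^{2t}\cosh(2x)}\,m_{|\alpha|+1}(0).$$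
   Context: $R$ is a real function of $(t,x)$, $x\in\mathbb{R}$. $R_0>0$ is a fixed constant and $R_b(t,x)=R_0e^{2t}\cosh(2x)$. For a multi-index $\alpha=(m,n)$, $\partial^\alpha=\partial_t^m\partial_x^n$ and $|\alpha|=m+n$. $\|f\|_\infty(t)=\sup_{x\in\mathbb{R}}|f(t,x)|$. Define $$m_0(t)=\|R-R_b\|_{C^0}+\|R_t-\partial_tR_b\|_{C^0},\qquad m_k(t)=\|R-R_b\|_{C^k}+\|R_t-\partial_tR_b\|_{C^{k-1}}\ (k\ge1),$$ where the functions are considered at time $t$ and the $C^k$ norms are taken over $x\in\mathbb{R}$. *)

theory Defs
  imports "HOL-Analysis.Analysis"
begin

text \<open>
  Functions of \<open>(t, x)\<close> are curried, with time first, and only their values for \<open>t \<ge> 0\<close>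
  matter: the domain is the closed half-plane \<open>t \<ge> 0\<close>, \<open>x \<in> \<real>\<close>, and time derivatives at
  \<open>t = 0\<close> are one-sided.
\<close>

definition dt :: "(real \<Rightarrow> real \<Rightarrow> real) \<Rightarrow> real \<Rightarrow> real \<Rightarrow> real" where
  "dt f t x = vector_derivative (\<lambda>s. f s x) (at t within {0..})"

definition dx :: "(real \<Rightarrow> real \<Rightarrow> real) \<Rightarrow> real \<Rightarrow> real \<Rightarrow> real" where
  "dx f t x = deriv (\<lambda>y. f t y) x"

definition partial :: "nat \<times> nat \<Rightarrow> (real \<Rightarrow> real \<Rightarrow> real) \<Rightarrow> real \<Rightarrow> real \<Rightarrow> real" where
  "partial \<alpha> f = (dt ^^ fst \<alpha>) ((dx ^^ snd \<alpha>) f)"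

definition mi_order :: "nat \<times> nat \<Rightarrow> nat" where
  "mi_order \<alpha> = fst \<alpha> + snd \<alpha>"

text \<open>
  \<open>C_k k f\<close>: all partial derivatives of \<open>f\<close> of order at most \<open>k\<close>, taken in any order, exist and
  are jointly continuous on the half-plane.
\<close>

fun C_k :: "nat \<Rightarrow> (real \<Rightarrow> real \<Rightarrow> real) \<Rightarrow> bool" where
  "C_k 0 f \<longleftrightarrow> continuous_on ({0..} \<times> UNIV) (\<lambda>(t, x). f t x)"
| "C_k (Suc k) f \<longleftrightarrow>
     continuous_on ({0..} \<times> UNIV) (\<lambda>(t, x). f t x) \<and>
     (\<forall>t\<ge>0. \<forall>x. (\<lambda>s. f s x) differentiable (at t within {0..}) \<and>
                (\<lambda>y. f t y) differentiable (at x)) \<and>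
     C_k k (dt f) \<and> C_k k (dx f)"

definition wave_solution :: "(real \<Rightarrow> real \<Rightarrow> real) \<Rightarrow> bool" where
  "wave_solution R \<longleftrightarrow> C_k 2 R \<and> (\<forall>t\<ge>0. \<forall>x. dx (dx R) t x - dt (dt R) t x = 0)"

definition R_b :: "real \<Rightarrow> real \<Rightarrow> real \<Rightarrow> real" where
  "R_b R0 t x = R0 * exp (2 * t) * cosh (2 * x)"

text \<open>
  Norms take values in \<^typ>\<open>ereal\<close>, so that the norm of an unbounded function is \<open>\<infinity>\<close>.  The
  \<open>C\<^sup>k\<close> norm is the maximum over \<open>j \<le> k\<close> of the sup norms of the \<open>j\<close>-th derivatives
  (the sum is at least as large and agrees with it for \<open>k = 0\<close>).
\<close>

definition sup_norm :: "(real \<Rightarrow> real) \<Rightarrow> ereal" where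
  "sup_norm g = (SUP x. ereal \<bar>g x\<bar>)"

definition C_k_norm :: "nat \<Rightarrow> (real \<Rightarrow> real) \<Rightarrow> ereal" where
  "C_k_norm k g = (SUP j\<in>{..k}. sup_norm ((deriv ^^ j) g))"

fun m_norm :: "real \<Rightarrow> (real \<Rightarrow> real \<Rightarrow> real) \<Rightarrow> nat \<Rightarrow> real \<Rightarrow> ereal" where
  "m_norm R0 R 0 t =
     C_k_norm 0 (\<lambda>x. R t x - R_b R0 t x) + C_k_norm 0 (\<lambda>x. dt R t x - dt (R_b R0) t x)"
| "m_norm R0 R (Suc k) t =
     C_k_norm (Suc k) (\<lambda>x. R t x - R_b R0 t x) + C_k_norm k (\<lambda>x. dt R t x - dt (R_b R0) t x)"

end

theory Submission imports Defs begin

text \<open>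
  Let \<open>u = R - R\<^sub>b\<close>, a solution of the wave equation with initial position \<open>h0\<close> and initial
  velocity \<open>h1\<close>.  The functions \<open>u\<^sub>t + u\<^sub>x\<close> and \<open>u\<^sub>t - u\<^sub>x\<close> are constant along the characteristics
  (\<open>wave_characteristics\<close>), so \<open>u\<^sub>t\<close> and \<open>u\<^sub>x\<close> are combinations of the travelling profiles
  \<open>h1 \<plusminus> h0'\<close> (\<open>dalembert_wave_perturbation\<close>).  Differentiating these profiles gives estimate (i),
  without growth in time; \<open>u\<close> itself is at most \<open>sup |h0| + t sup |h1|\<close>.
  Since \<open>e\<^sup>2\<^sup>t \<ge> 1 + t\<close>, the smallness of \<open>m\<^sub>0(0)\<close> then yields \<open>R \<ge> R\<^sub>b / 3 > 0\<close>.

  For (ii), write \<open>R\<^sub>z/R - (R\<^sub>b)\<^sub>z/R\<^sub>b = u\<^sub>z/R - ((R\<^sub>b)\<^sub>z/R\<^sub>b) (u/R)\<close> with \<open>z = t\<close> or \<open>z = x\<close>.  Its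
  derivatives of order \<open>k\<close> contain products of several derivatives of \<open>u\<close>, because \<open>R\<close> stands in
  the denominator, and yet the bound must be linear in \<open>m\<^sub>k\<^sub>+\<^sub>1(0)\<close> with a constant that does not
  depend on \<open>R\<close>.  Only \<open>m\<^sub>0(0)\<close> is bounded a priori, the intermediate norms are not.
  The way out is interpolation: if \<open>m\<^sub>k\<^sub>+\<^sub>1(0) = L\<^sup>k\<^sup>+\<^sup>1\<close> with \<open>L \<ge> 1\<close>, then the derivatives of \<open>u\<close> of
  order \<open>j\<close> are of size \<open>L\<^sup>j\<close> for \<open>1 \<le> j \<le> k + 1\<close>.  A product with at most \<open>k + 1\<close> derivatives
  in total is therefore of size \<open>L\<^sup>k\<^sup>+\<^sup>1 = m\<^sub>k\<^sub>+\<^sub>1(0)\<close>, however many factors it has.  If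
  \<open>m\<^sub>k\<^sub>+\<^sub>1(0) \<le> 1\<close>, all derivatives involved are at most that, hence at most 1, and since every
  product contains at least one of them, the bound is again linear.

  The predicate \<open>deriv_bounded\<close> does this bookkeeping: a bound \<open>c L\<^sup>j W\<close> on the derivatives of each
  order \<open>j\<close>, with a weight \<open>W\<close>.  It is preserved by sums, products and reciprocals, uniformly in
  \<open>L\<close>; the weights \<open>1 + t\<close> for \<open>u\<close> and \<open>e\<^sup>2\<^sup>t cosh 2x\<close> for \<open>R\<close> and \<open>R\<^sub>b\<close> produce the decay in (ii).
\<close>

section \<open>Derivatives on the half-plane\<close>

lemma at_within_neq_bot_if_Icc:
  fixes t :: real
  assumes "{t..t+1} \<subseteq> S"
  shows "at t within S \<noteq> bot"
proof -
  have "at t within {t..t+1} \<noteq> bot"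
    by (simp add: at_within_Icc_at_right)
  moreover have "at t within {t..t+1} \<le> at t within S"
    using assms by (intro at_le) auto
  ultimately show ?thesis
    by (metis bot.extremum_uniqueI)
qed

lemma dt_eqI:
  assumes "t \<ge> 0" "((\<lambda>s. f s x) has_real_derivative D) (at t within {0..})"
  shows "dt f t x = D"
  unfolding dt_def
  using assms
  by (intro vector_derivative_within at_within_neq_bot_if_Icc) (auto simp: has_real_derivative_iff_has_vector_derivative)

lemma dt_has_derivative:
  assumes "(\<lambda>s. f s x) differentiable (at t within {0..})"
  shows "((\<lambda>s. f s x) has_real_derivative dt f t x) (at t within {0..})"
  using assms unfolding dt_def has_real_derivative_iff_has_vector_derivative
  by (simp add: vector_derivative_works)

lemma dx_eqI: "((\<lambda>y. f t y) has_real_derivative D) (at x) \<Longrightarrow> dx f t x = D"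
  unfolding dx_def by (rule DERIV_imp_deriv)

lemma dx_has_derivative:
  assumes "(\<lambda>y. f t y) differentiable (at x)"
  shows "((\<lambda>y. f t y) has_real_derivative dx f t x) (at x)"
  using assms unfolding dx_def by (simp add: DERIV_deriv_iff_real_differentiable)

lemma dt_cong:
  assumes "\<And>s. s \<ge> 0 \<Longrightarrow> f s x = g s x" "t \<ge> 0"
  shows "dt f t x = dt g t x"
  unfolding dt_def
  by (rule vector_derivative_cong_eq) (use assms in auto)

lemma dx_cong:
  assumes "\<And>y. f t y = g t y"
  shows "dx f t x = dx g t x"
  unfolding dx_def using assms by presburger

lemma C_k_SucD:
  assumes "C_k (Suc k) f"
  shows "continuous_on ({0..} \<times> UNIV) (\<lambda>(t, x). f t x)"
    "\<And>t x. t \<ge> 0 \<Longrightarrow> ((\<lambda>s. f s x) has_real_derivative dt f t x) (at t within {0..})"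
    "\<And>t x. t \<ge> 0 \<Longrightarrow> (f t has_real_derivative dx f t x) (at x)"
    "C_k k (dt f)" "C_k k (dx f)"
  using assms by (auto intro: dt_has_derivative dx_has_derivative)

lemma C_k_continuous: "C_k k f \<Longrightarrow> continuous_on ({0..} \<times> UNIV) (\<lambda>(t, x). f t x)"
  by (cases k) auto

text \<open>
  On the half-plane the time derivatives at \<open>t = 0\<close> are one-sided, so the equality of mixed
  derivatives is obtained from the representation
  \<open>f T x = f 0 x + \<integral>\<^sub>0\<^sup>T f\<^sub>t s x ds\<close>: differentiating under the integral sign in \<open>x\<close> gives a
  formula for \<open>f\<^sub>x T x\<close> whose \<open>T\<close>-derivative, even at the boundary, is the integrand \<open>f\<^sub>t\<^sub>x\<close>.
\<close>

lemma clairaut: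
  assumes "C_k 2 f" "t \<ge> 0"
  shows "dt (dx f) t x = dx (dt f) t x"
proof -
  have f: "C_k (Suc (Suc 0)) f" using assms(1) by (simp only: numeral_2_eq_2)
  note f1 = C_k_SucD[OF f]
  note ft = C_k_SucD[OF f1(4)] and fx = C_k_SucD[OF f1(5)]
  have sub: "continuous_on {0..T} (\<lambda>s. g s y)"
    if "continuous_on ({0..} \<times> UNIV) (\<lambda>(t, x). g t x)" for g :: "real \<Rightarrow> real \<Rightarrow> real" and T y
  proof -
    have "continuous_on {0..T} (\<lambda>s. (\<lambda>(t, x). g t x) (s, y))"
      by (rule continuous_on_compose2[OF that]) (auto intro!: continuous_intros)
    then show ?thesis by simp
  qed
  have eq: "dx f T x = dx f 0 x + integral {0..T} (\<lambda>s. dx (dt f) s x)" if "T \<ge> 0" for T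
  proof -
    have *: "f T y = f 0 y + integral {0..T} (\<lambda>s. dt f s y)" for y
    proof -
      have "((\<lambda>s. dt f s y) has_integral (f T y - f 0 y)) {0..T}"
        using that f1(2) unfolding has_real_derivative_iff_has_vector_derivative
        by (intro fundamental_theorem_of_calculus)
           (auto intro: has_vector_derivative_within_subset[where S="{0..}"])
      then show ?thesis by (simp add: integral_unique)
    qed
    have "((\<lambda>y. integral (cbox 0 T) (\<lambda>s. dt f s y)) has_real_derivative
            integral (cbox 0 T) (\<lambda>s. dx (dt f) s x)) (at x within UNIV)"
    proof (rule leibniz_rule_field_derivative[where fx="\<lambda>y s. dx (dt f) s y"])
      show "((\<lambda>x. dt f s x) has_real_derivative dx (dt f) s y) (at y within UNIV)"
        if "s \<in> cbox 0 T" for y s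
        using ft(3)[of s y] that by simp
      show "(\<lambda>s. dt f s y) integrable_on cbox 0 T" for y
        using sub[OF ft(1)] by (intro integrable_continuous) auto
      have "continuous_on (UNIV \<times> cbox 0 T) (\<lambda>z. (\<lambda>(t, x). dx (dt f) t x) (snd z, fst z))"
        by (rule continuous_on_compose2[OF C_k_continuous[OF ft(5)]]) (auto intro!: continuous_intros)
      then show "continuous_on (UNIV \<times> cbox 0 T) (\<lambda>(y, s). dx (dt f) s y)"
        by (simp add: case_prod_unfold)
    qed auto
    then have "((\<lambda>y. f 0 y + integral {0..T} (\<lambda>s. dt f s y)) has_real_derivative
            dx f 0 x + integral {0..T} (\<lambda>s. dx (dt f) s x)) (at x)"
      using f1(3)[of 0 x] by (intro DERIV_add) auto
    then have "(f T has_real_derivative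
            dx f 0 x + integral {0..T} (\<lambda>s. dx (dt f) s x)) (at x)"
      using * by presburger
    then show ?thesis using f1(3)[OF that, of x] DERIV_unique by blast
  qed
  have I: "((\<lambda>T. dx f 0 x + integral {0..T} (\<lambda>s. dx (dt f) s x)) has_real_derivative
      0 + dx (dt f) t x) (at t within {0..t+1})"
    using assms(2) sub[OF C_k_continuous[OF ft(5)]]
    by (intro DERIV_add integral_has_real_derivative) auto
  have "((\<lambda>T. dx f T x) has_real_derivative 0 + dx (dt f) t x) (at t within {0..t+1})"
    by (rule has_field_derivative_transform_within[OF I zero_less_one]) (use assms(2) in \<open>auto simp: eq[symmetric]\<close>)
  moreover have "((\<lambda>T. dx f T x) has_real_derivative dt (dx f) t x) (at t within {0..t+1})"
    using fx(2)[OF assms(2), of x] by (rule DERIV_subset) auto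
  ultimately show ?thesis
    using assms(2) by (intro has_field_derivative_unique[symmetric, OF _ _ at_within_neq_bot_if_Icc, of "\<lambda>T. dx f T x" _ t "{0..t+1}"]) auto
qed

text \<open>
  The hypotheses say \<open>g\<^sub>t = \<sigma> g\<^sub>x\<close>, so \<open>g\<close> has derivative zero along the line
  \<open>s \<mapsto> (s, x + \<sigma> (t - s))\<close>, which joins \<open>(t, x)\<close> to the initial line.  The chain rule along it
  requires total differentiability, which follows from the continuity of one partial derivative.
\<close>

lemma transport:
  fixes g :: "real \<Rightarrow> real \<Rightarrow> real"
  assumes gt: "\<And>t x. t \<ge> 0 \<Longrightarrow> ((\<lambda>s. g s x) has_real_derivative \<sigma> * gx t x) (at t within {0..})"
    and gx: "\<And>t x. t \<ge> 0 \<Longrightarrow> (g t has_real_derivative gx t x) (at x)"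
    and cont: "continuous_on ({0..} \<times> UNIV) (\<lambda>(t, x). gx t x)"
    and "t \<ge> 0"
  shows "g t x = g 0 (x + \<sigma> * t)"
proof -
  have dg: "((\<lambda>(s, y). g s y) has_derivative (\<lambda>(h, k). \<sigma> * gx s y * h + gx s y * k))
      (at (s, y) within {0..} \<times> UNIV)" if "s \<ge> 0" for s y
  proof -
    have "((\<lambda>(s, y). g s y) has_derivative
        (\<lambda>(h, k). \<sigma> * gx s y * h + blinfun_apply (blinfun_mult_right (gx s y)) k))
      (at (s, y) within {0..} \<times> UNIV)"
    proof (rule has_derivative_partialsI[where fy="\<lambda>s y. blinfun_mult_right (gx s y)"])
      show "((\<lambda>s. g s y) has_derivative (*) (\<sigma> * gx s y)) (at s within {0..})"
        using gt[OF that] by (simp add: has_field_derivative_def)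
      show "((\<lambda>y. g r y) has_derivative blinfun_apply (blinfun_mult_right (gx r z)))
          (at z within UNIV)" if "r \<in> {0..}" for r z
        using gx[of r z] that by (simp add: has_field_derivative_def)
      have "continuous_on ({0..} \<times> UNIV) (\<lambda>(s, y). blinfun_mult_right (gx s y))"
        using cont by (auto simp: case_prod_unfold intro!: continuous_intros)
      then show "continuous (at (s, y) within {0..} \<times> UNIV)
          (\<lambda>(s, y). blinfun_mult_right (gx s y))"
        using that by (auto simp: continuous_on_eq_continuous_within)
    qed auto
    then show ?thesis by simp
  qed
  have "((\<lambda>s. g s (x + \<sigma> * (t - s))) has_derivative (\<lambda>h. 0)) (at s within {0..t})"
    if "s \<in> {0..t}" for s
  proof -
    have "((\<lambda>(s, y). g s y) has_derivative
        (\<lambda>(h, k). \<sigma> * gx s (x + \<sigma> * (t - s)) * h + gx s (x + \<sigma> * (t - s)) * k))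
      (at (s, x + \<sigma> * (t - s)) within (\<lambda>s. (s, x + \<sigma> * (t - s))) ` {0..t})"
      by (rule has_derivative_subset[OF dg]) (use that in auto)
    moreover have "((\<lambda>s. (s, x + \<sigma> * (t - s))) has_derivative (\<lambda>h. (h, - \<sigma> * h)))
        (at s within {0..t})"
      by (auto intro!: derivative_eq_intros)
    ultimately have "((\<lambda>s. (\<lambda>(s, y). g s y) (s, x + \<sigma> * (t - s))) has_derivative
        (\<lambda>h. (\<lambda>(h, k). \<sigma> * gx s (x + \<sigma> * (t - s)) * h + gx s (x + \<sigma> * (t - s)) * k) (h, - \<sigma> * h)))
        (at s within {0..t})"
      by (rule has_derivative_in_compose[rotated])
    then show ?thesis by (simp add: algebra_simps)
  qed
  then have "g t (x + \<sigma> * (t - t)) = g 0 (x + \<sigma> * (t - 0))"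
    by (rule has_derivative_zero_unique[of "{0..t}" "\<lambda>s. g s (x + \<sigma> * (t - s))", rotated])
       (use \<open>t \<ge> 0\<close> in auto)
  then show ?thesis by simp
qed

section \<open>Interpolation between derivatives on the line\<close>

fun times_diff :: "nat \<Rightarrow> (real \<Rightarrow> real) \<Rightarrow> bool" where
  "times_diff 0 h \<longleftrightarrow> True"
| "times_diff (Suc n) h \<longleftrightarrow> (\<forall>x. h differentiable (at x)) \<and> times_diff n (deriv h)"

lemma times_diff_SucD:
  assumes "times_diff (Suc n) h"
  shows "(h has_real_derivative deriv h x) (at x)" "times_diff n (deriv h)"
  using assms by (auto simp: DERIV_deriv_iff_real_differentiable)

lemma times_diff_SucI:
  assumes "\<And>x. (h has_real_derivative h' x) (at x)" "times_diff n h'"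
  shows "times_diff (Suc n) h"
proof -
  have "deriv h = h'" using assms(1) by (auto intro: DERIV_imp_deriv)
  then show ?thesis using assms by (auto simp: real_differentiable_def)
qed

lemma times_diff_mono: "times_diff n h \<Longrightarrow> m \<le> n \<Longrightarrow> times_diff m h"
proof (induction n arbitrary: h m)
  case (Suc n)
  then show ?case by (cases m) auto
qed auto

lemma higher_deriv_lincomb:
  assumes "times_diff n f" "times_diff n g"
  shows "times_diff n (\<lambda>x. a * f x + b * g x)"
    and "j \<le> n \<Longrightarrow> (deriv ^^ j) (\<lambda>x. a * f x + b * g x) = (\<lambda>x. a * (deriv ^^ j) f x + b * (deriv ^^ j) g x)"
proof -
  have "times_diff n (\<lambda>x. a * f x + b * g x) \<and>
    (j \<le> n \<longrightarrow> (deriv ^^ j) (\<lambda>x. a * f x + b * g x) = (\<lambda>x. a * (deriv ^^ j) f x + b * (deriv ^^ j) g x))"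
    using assms
  proof (induction n arbitrary: f g j)
    case (Suc n)
    note f = times_diff_SucD[OF Suc.prems(1)] and g = times_diff_SucD[OF Suc.prems(2)]
    have D: "((\<lambda>x. a * f x + b * g x) has_real_derivative a * deriv f x + b * deriv g x) (at x)" for x
      by (auto intro!: derivative_eq_intros f g)
    have eq: "deriv (\<lambda>x. a * f x + b * g x) = (\<lambda>x. a * deriv f x + b * deriv g x)"
      using D by (auto intro: DERIV_imp_deriv)
    note IH = Suc.IH[OF f(2) g(2)]
    show ?case
    proof (intro conjI impI)
      show "times_diff (Suc n) (\<lambda>x. a * f x + b * g x)"
        by (rule times_diff_SucI[OF D conjunct1[OF IH]])
      assume "j \<le> Suc n"
      then show "(deriv ^^ j) (\<lambda>x. a * f x + b * g x) = (\<lambda>x. a * (deriv ^^ j) f x + b * (deriv ^^ j) g x)"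
        using IH[of "j - 1"] by (cases j) (auto simp: funpow_Suc_right eq simp del: funpow.simps)
    qed
  qed auto
  then show "times_diff n (\<lambda>x. a * f x + b * g x)"
    "j \<le> n \<Longrightarrow> (deriv ^^ j) (\<lambda>x. a * f x + b * g x) = (\<lambda>x. a * (deriv ^^ j) f x + b * (deriv ^^ j) g x)"
    by auto
qed

lemma times_diff_funpow_deriv:
  "times_diff (j + n) h \<Longrightarrow> times_diff n ((deriv ^^ j) h)"
  by (induction j arbitrary: h) (auto simp: funpow_Suc_right simp del: funpow.simps)

lemma shifted_deriv:
  fixes d :: real
  assumes "times_diff (Suc n) h"
  shows "((\<lambda>x. h (x + d)) has_real_derivative deriv h (x + d)) (at x)"
  using times_diff_SucD(1)[OF assms, of "x + d"] by (simp add: DERIV_shift)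

lemma times_diff_shift:
  fixes d :: real
  assumes "times_diff n h"
  shows "times_diff n (\<lambda>x. h (x + d))"
    and "j \<le> n \<Longrightarrow> (deriv ^^ j) (\<lambda>x. h (x + d)) = (\<lambda>x. (deriv ^^ j) h (x + d))"
proof -
  have "times_diff n (\<lambda>x. h (x + d)) \<and>
    (j \<le> n \<longrightarrow> (deriv ^^ j) (\<lambda>x. h (x + d)) = (\<lambda>x. (deriv ^^ j) h (x + d)))"
    using assms
  proof (induction n arbitrary: h j)
    case (Suc n)
    have D: "((\<lambda>x. h (x + d)) has_real_derivative deriv h (x + d)) (at x)" for x
      using shifted_deriv[OF Suc.prems] .
    have eq: "deriv (\<lambda>x. h (x + d)) = (\<lambda>x. deriv h (x + d))"
      using D by (auto intro: DERIV_imp_deriv)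
    note IH = Suc.IH[OF times_diff_SucD(2)[OF Suc.prems]]
    show ?case
    proof (intro conjI impI)
      show "times_diff (Suc n) (\<lambda>x. h (x + d))"
        by (rule times_diff_SucI[OF D conjunct1[OF IH]])
      assume "j \<le> Suc n"
      then show "(deriv ^^ j) (\<lambda>x. h (x + d)) = (\<lambda>x. (deriv ^^ j) h (x + d))"
        using IH[of "j - 1"] by (cases j) (auto simp: funpow_Suc_right eq simp del: funpow.simps)
    qed
  qed auto
  then show "times_diff n (\<lambda>x. h (x + d))"
    "j \<le> n \<Longrightarrow> (deriv ^^ j) (\<lambda>x. h (x + d)) = (\<lambda>x. (deriv ^^ j) h (x + d))" by auto
qed

text \<open>
  The \<open>n\<close>-th forward difference of \<open>h\<close> with step \<open>d\<close> is at most \<open>2\<^sup>n A\<close> and, by \<open>n\<close> applications of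
  the mean value theorem, equals \<open>d\<^sup>n\<close> times an \<open>n\<close>-th derivative at some nearby point.
  The induction peels off one difference at a time.
\<close>

lemma exists_small_higher_deriv:
  assumes "times_diff n h" "\<And>y. \<bar>h y\<bar> \<le> A" "d > 0"
  shows "\<exists>\<xi>. x \<le> \<xi> \<and> \<xi> \<le> x + real n * d \<and> \<bar>(deriv ^^ n) h \<xi>\<bar> \<le> 2 ^ n * A / d ^ n"
  using assms(1,2)
proof (induction n arbitrary: h A)
  case 0
  then show ?case by (auto intro: exI[of _ x])
next
  case (Suc n)
  define g where "g y = h (y + d) - h y" for y
  have h: "times_diff n h" using Suc.prems(1) times_diff_mono le_SucI by blast
  note sh = times_diff_shift[OF h, where d=d]
  have g_eq: "g = (\<lambda>y. 1 * h (y + d) + (-1) * h y)" by (auto simp: g_def)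
  have g: "times_diff n g" unfolding g_eq by (rule higher_deriv_lincomb(1)[OF sh(1) h])
  have gn: "(deriv ^^ n) g y = (deriv ^^ n) h (y + d) - (deriv ^^ n) h y" for y
    unfolding g_eq using higher_deriv_lincomb(2)[OF sh(1) h, of n 1 "-1"] sh(2)[of n] by simp
  have "\<bar>g y\<bar> \<le> 2 * A" for y
    using Suc.prems(2)[of y] Suc.prems(2)[of "y + d"] by (simp add: g_def)
  from Suc.IH[OF g this] obtain \<xi> where \<xi>: "x \<le> \<xi>" "\<xi> \<le> x + real n * d"
    "\<bar>(deriv ^^ n) g \<xi>\<bar> \<le> 2 ^ n * (2 * A) / d ^ n" by blast
  have "times_diff (Suc 0) ((deriv ^^ n) h)"
    using times_diff_funpow_deriv[of n "Suc 0" h] Suc.prems(1) by simp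
  from times_diff_SucD(1)[OF this]
  have "((deriv ^^ n) h has_real_derivative (deriv ^^ Suc n) h y) (at y)" for y by simp
  then obtain \<eta> where \<eta>: "\<xi> < \<eta>" "\<eta> < \<xi> + d"
    "(deriv ^^ n) h (\<xi> + d) - (deriv ^^ n) h \<xi> = d * (deriv ^^ Suc n) h \<eta>"
    using MVT2[of \<xi> "\<xi> + d" "(deriv ^^ n) h" "(deriv ^^ Suc n) h"] assms(3) by auto
  have "d * \<bar>(deriv ^^ Suc n) h \<eta>\<bar> \<le> 2 ^ n * (2 * A) / d ^ n"
    using \<xi>(3) \<eta>(3) assms(3) by (simp add: gn abs_mult)
  then have "\<bar>(deriv ^^ Suc n) h \<eta>\<bar> \<le> 2 ^ Suc n * A / d ^ Suc n"
    using assms(3) by (simp add: field_simps)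
  moreover have "x \<le> \<eta>" "\<eta> \<le> x + real (Suc n) * d"
    using \<xi> \<eta> by (auto simp: algebra_simps)
  ultimately show ?case by blast
qed

text \<open>
  A scaled Landau--Kolmogorov inequality.  Think of \<open>L\<close> as the inverse of a length: at unit length
  scale the bounds on \<open>h\<close> and on its \<open>n\<close>-th derivative control all derivatives in between.  The
  induction lowers the order of the top derivative by one: the point \<open>\<xi>\<close> at distance at most
  \<open>n / L\<close> where the \<open>n\<close>-th derivative is small exists by the preceding lemma, and the bound on the
  derivative of order \<open>n + 1\<close> carries this smallness over to every point.
\<close>

lemma interpolation:
  "\<exists>C\<ge>0. \<forall>h A B L j. times_diff n h \<longrightarrow> L > 0 \<longrightarrow> (\<forall>y. \<bar>h y\<bar> \<le> A) \<longrightarrow>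
     (\<forall>y. \<bar>(deriv ^^ n) h y\<bar> \<le> B * L ^ n) \<longrightarrow> j \<le> n \<longrightarrow>
     (\<forall>y. \<bar>(deriv ^^ j) h y\<bar> \<le> C * (A + B) * L ^ j)"
proof (induction n)
  case 0
  show ?case by (rule exI[of _ 1]) (auto intro: add_increasing2 order_trans[OF abs_ge_zero])
next
  case (Suc n)
  then obtain C where C: "C \<ge> 0" "\<And>h A B L j y. times_diff n h \<Longrightarrow> L > 0 \<Longrightarrow> (\<And>y. \<bar>h y\<bar> \<le> A) \<Longrightarrow>
     (\<And>y. \<bar>(deriv ^^ n) h y\<bar> \<le> B * L ^ n) \<Longrightarrow> j \<le> n \<Longrightarrow>
     \<bar>(deriv ^^ j) h y\<bar> \<le> C * (A + B) * L ^ j"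
    by metis
  \<comment> \<open>the induction hypothesis is used with \<open>2\<^sup>n A + n B\<close> in place of \<open>B\<close>; the summand 1 serves the order \<open>n + 1\<close>\<close>
  define D where "D = C * (1 + 2 ^ n + real n) + 1"
  have "\<bar>(deriv ^^ j) h y\<bar> \<le> D * (A + B) * L ^ j"
    if h: "times_diff (Suc n) h" and L: "L > 0" and hA: "\<And>y. \<bar>h y\<bar> \<le> A"
      and hB: "\<And>y. \<bar>(deriv ^^ Suc n) h y\<bar> \<le> B * L ^ Suc n" and j: "j \<le> Suc n"
    for h A B L j y
  proof -
    have A: "A \<ge> 0" using hA[of 0] by linarith
    have "0 \<le> B * L ^ Suc n" using hB[of 0] by linarith
    then have B: "B \<ge> 0" using L mult_neg_pos[of B "L ^ Suc n"] by force
    have hn: "times_diff n h" using h times_diff_mono le_SucI by blast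
    have "times_diff (Suc 0) ((deriv ^^ n) h)"
      using times_diff_funpow_deriv[of n "Suc 0" h] h by simp
    from times_diff_SucD(1)[OF this]
    have der: "((deriv ^^ n) h has_real_derivative (deriv ^^ Suc n) h y) (at y)" for y by simp
    have top: "\<bar>(deriv ^^ n) h y\<bar> \<le> (2 ^ n * A + real n * B) * L ^ n" for y
    proof -
      obtain \<xi> where \<xi>: "y \<le> \<xi>" "\<xi> \<le> y + real n / L" "\<bar>(deriv ^^ n) h \<xi>\<bar> \<le> 2 ^ n * A * L ^ n"
        using exists_small_higher_deriv[OF hn hA, of "1 / L" y] L by (auto simp: power_one_over field_simps)
      have "\<bar>(deriv ^^ n) h y - (deriv ^^ n) h \<xi>\<bar> \<le> B * L ^ Suc n * \<bar>y - \<xi>\<bar>"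
        using field_differentiable_bound[of UNIV "(deriv ^^ n) h" "(deriv ^^ Suc n) h" "B * L ^ Suc n" y \<xi>]
          der hB by simp
      also have "\<dots> \<le> B * L ^ Suc n * (real n / L)"
        using \<xi> B L by (intro mult_left_mono) auto
      also have "\<dots> = real n * B * L ^ n" using L by simp
      finally show ?thesis using \<xi>(3) by (simp add: algebra_simps)
    qed
    show ?thesis
    proof (cases "j \<le> n")
      case True
      have "\<bar>(deriv ^^ j) h y\<bar> \<le> C * (A + (2 ^ n * A + real n * B)) * L ^ j"
        by (rule C(2)[OF hn L hA top True])
      also have "\<dots> \<le> D * (A + B) * L ^ j"
      proof (rule mult_right_mono)
        have "A + (2 ^ n * A + real n * B) \<le> (1 + 2 ^ n + real n) * (A + B)"
          using A B by (simp add: algebra_simps)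
        then have "C * (A + (2 ^ n * A + real n * B)) \<le> C * ((1 + 2 ^ n + real n) * (A + B))"
          by (rule mult_left_mono[OF _ C(1)])
        also have "\<dots> \<le> D * (A + B)" using A B by (simp add: D_def algebra_simps)
        finally show "C * (A + (2 ^ n * A + real n * B)) \<le> D * (A + B)" .
      qed (use L in auto)
      finally show ?thesis .
    next
      case False
      then have "j = Suc n" using j by simp
      moreover have "B \<le> D * (A + B)"
      proof -
        have "1 \<le> D" using C(1) by (simp add: D_def)
        then have "1 * (A + B) \<le> D * (A + B)" using A B by (intro mult_right_mono) auto
        then show ?thesis using A by simp
      qed
      ultimately show ?thesis
        using hB[of y] L by (metis (no_types, lifting) mult_right_mono order_trans zero_le_power less_imp_le)
    qed
  qed
  moreover have "D \<ge> 0" using C(1) by (simp add: D_def)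
  ultimately show ?case by blast
qed

section \<open>A calculus of weighted derivative bounds\<close>

text \<open>
  Every derivative of order \<open>j \<le> n\<close>, taken in any order of \<open>t\<close> and \<open>x\<close>, exists on the half-plane
  and is at most \<open>c L\<^sup>j W\<close>: each derivative costs one factor \<open>L\<close>, while the weight \<open>W\<close> stays the
  same.  This shape is stable under products and reciprocals, with weights multiplying and
  constants that do not depend on \<open>L\<close>; that uniformity in \<open>L\<close> is the point of the definition.
\<close>

fun deriv_bounded ::
  "real \<Rightarrow> nat \<Rightarrow> real \<Rightarrow> (real \<Rightarrow> real \<Rightarrow> real) \<Rightarrow> (real \<Rightarrow> real \<Rightarrow> real) \<Rightarrow> bool" where
  "deriv_bounded L 0 c W f \<longleftrightarrow> (\<forall>t\<ge>0. \<forall>x. \<bar>f t x\<bar> \<le> c * W t x)"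
| "deriv_bounded L (Suc n) c W f \<longleftrightarrow>
     (\<forall>t\<ge>0. \<forall>x. \<bar>f t x\<bar> \<le> c * W t x) \<and>
     (\<forall>t\<ge>0. \<forall>x. (\<lambda>s. f s x) differentiable (at t within {0..}) \<and>
                (\<lambda>y. f t y) differentiable (at x)) \<and>
     deriv_bounded L n (c * L) W (dt f) \<and> deriv_bounded L n (c * L) W (dx f)"

lemma deriv_bounded_SucD:
  assumes "deriv_bounded L (Suc n) c W f"
  shows "\<And>t x. t \<ge> 0 \<Longrightarrow> ((\<lambda>s. f s x) has_real_derivative dt f t x) (at t within {0..})"
    "\<And>t x. t \<ge> 0 \<Longrightarrow> (f t has_real_derivative dx f t x) (at x)"
    "deriv_bounded L n (c * L) W (dt f)" "deriv_bounded L n (c * L) W (dx f)"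
  using assms by (auto intro: dt_has_derivative dx_has_derivative)

lemma deriv_boundedD: "deriv_bounded L n c W f \<Longrightarrow> t \<ge> 0 \<Longrightarrow> \<bar>f t x\<bar> \<le> c * W t x"
  by (cases n) auto

text \<open>
  Since \<open>dt\<close> differentiates within the half-line, agreement for \<open>t \<ge> 0\<close> passes to all derivatives.
\<close>

lemma deriv_bounded_cong:
  assumes "deriv_bounded L n c W f" "\<And>t x. t \<ge> 0 \<Longrightarrow> f t x = g t x"
  shows "deriv_bounded L n c W g"
  using assms
proof (induction n arbitrary: c f g)
  case (Suc n)
  have "(\<lambda>s. g s x) differentiable (at t within {0..})" if "t \<ge> 0" for t x
    by (rule differentiable_transform_within[where d=1 and f="\<lambda>s. f s x"])
       (use Suc.prems that in auto)
  moreover have "g t differentiable (at x)" if "t \<ge> 0" for t x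
  proof -
    have "f t = g t" using Suc.prems(2)[OF that] by auto
    then show ?thesis using Suc.prems(1) that by auto
  qed
  moreover have "deriv_bounded L n (c * L) W (dt g)"
  proof (rule Suc.IH)
    show "deriv_bounded L n (c * L) W (dt f)" using Suc.prems(1) by simp
    show "dt f t x = dt g t x" if "t \<ge> 0" for t x
      by (rule dt_cong) (use Suc.prems(2) that in auto)
  qed
  moreover have "deriv_bounded L n (c * L) W (dx g)"
  proof (rule Suc.IH)
    show "deriv_bounded L n (c * L) W (dx f)" using Suc.prems(1) by simp
    show "dx f t x = dx g t x" if "t \<ge> 0" for t x
      by (rule dx_cong) (use Suc.prems(2) that in auto)
  qed
  moreover have "\<bar>g t x\<bar> \<le> c * W t x" if "t \<ge> 0" for t x
    using deriv_boundedD[OF Suc.prems(1) that, of x] Suc.prems(2)[OF that] by simp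
  ultimately show ?case by simp
qed auto

lemma deriv_bounded_SucI:
  assumes "\<And>t x. t \<ge> 0 \<Longrightarrow> \<bar>f t x\<bar> \<le> c * W t x"
    and ft: "\<And>t x. t \<ge> 0 \<Longrightarrow> ((\<lambda>s. f s x) has_real_derivative ft t x) (at t within {0..})"
    and fx: "\<And>t x. t \<ge> 0 \<Longrightarrow> (f t has_real_derivative fx t x) (at x)"
    and "deriv_bounded L n (c * L) W ft" "deriv_bounded L n (c * L) W fx"
  shows "deriv_bounded L (Suc n) c W f"
proof -
  have "deriv_bounded L n (c * L) W (dt f)"
    by (rule deriv_bounded_cong[OF assms(4)]) (use dt_eqI[OF _ ft] in auto)
  moreover have "deriv_bounded L n (c * L) W (dx f)"
    by (rule deriv_bounded_cong[OF assms(5)]) (use dx_eqI[OF fx] in auto)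
  ultimately show ?thesis
    unfolding deriv_bounded.simps real_differentiable_def using assms(1) ft fx by blast
qed

lemma deriv_bounded_mono:
  assumes "deriv_bounded L n c W f" "m \<le> n" "c \<le> d" "0 \<le> d" "0 \<le> L"
    "\<And>t x. t \<ge> 0 \<Longrightarrow> 0 \<le> W t x \<and> W t x \<le> V t x"
  shows "deriv_bounded L m d V f"
  using assms
proof (induction n arbitrary: c d f m)
  case 0
  have "\<bar>f t x\<bar> \<le> d * V t x" if "t \<ge> 0" for t x
    using deriv_boundedD[OF 0(1) that, of x] mult_mono[OF 0(3) conjunct2[OF 0(6)] 0(4) conjunct1[OF 0(6)], OF that that, of x]
    by linarith
  then show ?case using 0(2) by simp
next
  case (Suc n)
  have b: "\<bar>f t x\<bar> \<le> d * V t x" if "t \<ge> 0" for t x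
    using deriv_boundedD[OF Suc.prems(1) that, of x]
      mult_mono[OF Suc.prems(3) conjunct2[OF Suc.prems(6)] Suc.prems(4) conjunct1[OF Suc.prems(6)], OF that that, of x]
    by linarith
  show ?case
  proof (cases m)
    case (Suc k)
    have le: "k \<le> n" "c * L \<le> d * L" "0 \<le> d * L"
      using Suc Suc.prems(2-5) by (auto intro: mult_right_mono)
    have "deriv_bounded L k (d * L) V (dt f)" "deriv_bounded L k (d * L) V (dx f)"
      using Suc.IH[OF deriv_bounded_SucD(3)[OF Suc.prems(1)] le Suc.prems(5,6)]
        Suc.IH[OF deriv_bounded_SucD(4)[OF Suc.prems(1)] le Suc.prems(5,6)] by auto
    then show ?thesis using Suc b Suc.prems(1) by auto
  qed (use b in auto)
qed

lemma deriv_bounded_pred: "deriv_bounded L (Suc n) c W f \<Longrightarrow> deriv_bounded L n c W f"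
proof (induction n arbitrary: c f)
  case (Suc n)
  from Suc.prems show ?case
    using Suc.IH[OF deriv_bounded_SucD(3)[OF Suc.prems]] Suc.IH[OF deriv_bounded_SucD(4)[OF Suc.prems]]
    by (simp only: deriv_bounded.simps) blast
qed simp

lemma deriv_bounded_add:
  assumes "deriv_bounded L n c W f" "deriv_bounded L n d W g"
  shows "deriv_bounded L n (c + d) W (\<lambda>t x. f t x + g t x)"
  using assms
proof (induction n arbitrary: c d f g)
  case 0
  have "\<bar>f t x + g t x\<bar> \<le> (c + d) * W t x" if "t \<ge> 0" for t x
    using deriv_boundedD[OF 0(1) that, of x] deriv_boundedD[OF 0(2) that, of x]
    by (simp add: algebra_simps)
  then show ?case by simp
next
  case (Suc n)
  note f = deriv_bounded_SucD[OF Suc.prems(1)] and g = deriv_bounded_SucD[OF Suc.prems(2)]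
  show ?case
  proof (rule deriv_bounded_SucI[where ft="\<lambda>t x. dt f t x + dt g t x" and fx="\<lambda>t x. dx f t x + dx g t x"])
    show "\<bar>f t x + g t x\<bar> \<le> (c + d) * W t x" if "t \<ge> 0" for t x
      using deriv_boundedD[OF Suc.prems(1) that, of x] deriv_boundedD[OF Suc.prems(2) that, of x]
      by (simp add: algebra_simps)
    show "deriv_bounded L n ((c + d) * L) W (\<lambda>t x. dt f t x + dt g t x)"
      "deriv_bounded L n ((c + d) * L) W (\<lambda>t x. dx f t x + dx g t x)"
      using Suc.IH[OF f(3) g(3)] Suc.IH[OF f(4) g(4)] by (auto simp: distrib_right)
  qed (auto intro!: DERIV_add f g)
qed

lemma deriv_bounded_cmult:
  assumes "deriv_bounded L n c W f"
  shows "deriv_bounded L n (\<bar>a\<bar> * c) W (\<lambda>t x. a * f t x)"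
  using assms
proof (induction n arbitrary: c f)
  case 0
  then show ?case by (auto simp: abs_mult mult.assoc mult_left_mono)
next
  case (Suc n)
  note f = deriv_bounded_SucD[OF Suc.prems(1)]
  show ?case
  proof (rule deriv_bounded_SucI[where ft="\<lambda>t x. a * dt f t x" and fx="\<lambda>t x. a * dx f t x"])
    show "\<bar>a * f t x\<bar> \<le> (\<bar>a\<bar> * c) * W t x" if "t \<ge> 0" for t x
      using deriv_boundedD[OF Suc.prems that, of x] by (auto simp: abs_mult mult.assoc mult_left_mono)
    show "deriv_bounded L n (\<bar>a\<bar> * c * L) W (\<lambda>t x. a * dt f t x)"
      "deriv_bounded L n (\<bar>a\<bar> * c * L) W (\<lambda>t x. a * dx f t x)"
      using Suc.IH[OF f(3)] Suc.IH[OF f(4)] by (auto simp: mult.assoc)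
  qed (auto intro!: DERIV_cmult f)
qed

lemma deriv_bounded_mult:
  assumes "deriv_bounded L n c W f" "deriv_bounded L n d V g"
  shows "deriv_bounded L n (2 ^ n * c * d) (\<lambda>t x. W t x * V t x) (\<lambda>t x. f t x * g t x)"
  using assms
proof (induction n arbitrary: c d f g)
  case 0
  have "\<bar>f t x * g t x\<bar> \<le> (c * W t x) * (d * V t x)" if "t \<ge> 0" for t x
    using mult_mono[OF deriv_boundedD[OF 0(1) that] deriv_boundedD[OF 0(2) that]
        order_trans[OF abs_ge_zero deriv_boundedD[OF 0(1) that]] abs_ge_zero, of x x]
    by (simp add: abs_mult)
  then show ?case by (simp add: mult_ac)
next
  case (Suc n)
  note f = deriv_bounded_SucD[OF Suc.prems(1)] and g = deriv_bounded_SucD[OF Suc.prems(2)]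
  note f0 = deriv_bounded_pred[OF Suc.prems(1)] and g0 = deriv_bounded_pred[OF Suc.prems(2)]
  show ?case
  proof (rule deriv_bounded_SucI[where ft="\<lambda>t x. dt f t x * g t x + f t x * dt g t x"
        and fx="\<lambda>t x. dx f t x * g t x + f t x * dx g t x"])
    show "\<bar>f t x * g t x\<bar> \<le> (2 ^ Suc n * c * d) * (W t x * V t x)" if "t \<ge> 0" for t x
    proof -
      have "\<bar>f t x * g t x\<bar> \<le> (c * W t x) * (d * V t x)"
        using mult_mono[OF deriv_boundedD[OF Suc.prems(1) that] deriv_boundedD[OF Suc.prems(2) that]
            order_trans[OF abs_ge_zero deriv_boundedD[OF Suc.prems(1) that]] abs_ge_zero, of x x]
        by (simp add: abs_mult)
      moreover have "1 * ((c * W t x) * (d * V t x)) \<le> 2 ^ Suc n * ((c * W t x) * (d * V t x))"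
        by (intro mult_right_mono one_le_power order_trans[OF abs_ge_zero calculation]) auto
      ultimately show ?thesis by (simp add: mult_ac)
    qed
    show "deriv_bounded L n (2 ^ Suc n * c * d * L) (\<lambda>t x. W t x * V t x)
        (\<lambda>t x. dt f t x * g t x + f t x * dt g t x)"
      using deriv_bounded_add[OF Suc.IH[OF f(3) g0] Suc.IH[OF f0 g(3)]]
      by (simp add: algebra_simps)
    show "deriv_bounded L n (2 ^ Suc n * c * d * L) (\<lambda>t x. W t x * V t x)
        (\<lambda>t x. dx f t x * g t x + f t x * dx g t x)"
      using deriv_bounded_add[OF Suc.IH[OF f(4) g0] Suc.IH[OF f0 g(4)]]
      by (simp add: algebra_simps)
    show "((\<lambda>s. f s x * g s x) has_real_derivative dt f t x * g t x + f t x * dt g t x) (at t within {0..})"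
      "((\<lambda>x. f t x * g t x) has_real_derivative dx f t x * g t x + f t x * dx g t x) (at x)"
      if "t \<ge> 0" for t x
      using DERIV_mult'[OF f(1)[OF that] g(1)[OF that]] DERIV_mult'[OF f(2)[OF that] g(2)[OF that]]
      by (simp_all add: add.commute)
  qed
qed

text \<open>
  From \<open>(1/f)' = - f' (1/f)\<^sup>2\<close>: bounds for \<open>1/f\<close> up to order \<open>n\<close> give them up to order \<open>n + 1\<close> by
  the product rule, the weights combining to \<open>E (1/E)\<^sup>2 = 1/E\<close>.  The order of quantifiers matters:
  one constant serves all scales \<open>L\<close>, all weights and all functions.
\<close>

lemma deriv_bounded_inverse:
  assumes "c \<ge> 0" "r > 0"
  shows "\<exists>C\<ge>0. \<forall>L\<ge>0. \<forall>E f. (\<forall>t\<ge>0. \<forall>x. E t x > 0 \<and> f t x \<ge> r * E t x) \<longrightarrow> deriv_bounded L n c E f \<longrightarrow>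
    deriv_bounded L n C (\<lambda>t x. 1 / E t x) (\<lambda>t x. 1 / f t x)"
proof -
  have base: "\<bar>1 / a\<bar> \<le> 1 / r * (1 / e)" if "e > 0 \<and> a \<ge> r * e" for a e :: real
  proof -
    have "r * e > 0" using that assms(2) by simp
    then show ?thesis using that frac_le[of 1 1 "r * e" a] by simp
  qed
  show ?thesis
  proof (induction n)
    case 0
    show ?case by (rule exI[of _ "1 / r"]) (use base assms in auto)
  next
    case (Suc n)
    then obtain C where C: "C \<ge> 0" and C_all: "\<forall>L\<ge>0. \<forall>E f. (\<forall>t\<ge>0. \<forall>x. E t x > 0 \<and> f t x \<ge> r * E t x) \<longrightarrow>
        deriv_bounded L n c E f \<longrightarrow> deriv_bounded L n C (\<lambda>t x. 1 / E t x) (\<lambda>t x. 1 / f t x)"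
      by blast
    define D where "D = 1 / r + 2 ^ n * (2 ^ n * c * C) * C"
    have D: "D \<ge> 0" "D \<ge> 1 / r" "D \<ge> 2 ^ n * (2 ^ n * c * C) * C" using C assms by (auto simp: D_def)
    have step: "deriv_bounded L (Suc n) D (\<lambda>t x. 1 / E t x) (\<lambda>t x. 1 / f t x)"
      if L: "L \<ge> 0" and E: "\<And>t x. t \<ge> 0 \<Longrightarrow> E t x > 0 \<and> f t x \<ge> r * E t x"
        and f: "deriv_bounded L (Suc n) c E f" for L E f
    proof -
      note f1 = deriv_bounded_SucD[OF f]
      have pos: "f t x > 0" if "t \<ge> 0" for t x
        using E[OF that, of x] assms(2) by (meson mult_pos_pos less_le_trans)
      have inv: "deriv_bounded L n C (\<lambda>t x. 1 / E t x) (\<lambda>t x. 1 / f t x)"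
        using C_all L E deriv_bounded_pred[OF f] by blast
      have *: "deriv_bounded L n (D * L) (\<lambda>t x. 1 / E t x) (\<lambda>t x. (-1) * (g t x * (1 / f t x) * (1 / f t x)))"
        if g: "deriv_bounded L n (c * L) E g" for g
      proof (rule deriv_bounded_mono[OF deriv_bounded_cmult[OF deriv_bounded_mult[OF deriv_bounded_mult[OF g inv] inv]]])
        show "0 \<le> E t x * (1 / E t x) * (1 / E t x) \<and> E t x * (1 / E t x) * (1 / E t x) \<le> 1 / E t x"
          if "t \<ge> 0" for t x using E[OF that, of x] by simp
        show "\<bar>- 1\<bar> * (2 ^ n * (2 ^ n * (c * L) * C) * C) \<le> D * L"
          using mult_right_mono[OF D(3) L] by (simp add: mult_ac)
      qed (use D L in auto)
      show ?thesis
      proof (rule deriv_bounded_SucI[OF _ _ _ *[OF f1(3)] *[OF f1(4)]])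
        show "\<bar>1 / f t x\<bar> \<le> D * (1 / E t x)" if "t \<ge> 0" for t x
        proof -
          have "\<bar>1 / f t x\<bar> \<le> 1 / r * (1 / E t x)" by (rule base[OF E[OF that]])
          also have "\<dots> \<le> D * (1 / E t x)"
            using D(2) E[OF that, of x] by (intro mult_right_mono) auto
          finally show ?thesis .
        qed
        show "((\<lambda>s. 1 / f s x) has_real_derivative - 1 * (dt f t x * (1 / f t x) * (1 / f t x))) (at t within {0..})"
          "((\<lambda>x. 1 / f t x) has_real_derivative - 1 * (dx f t x * (1 / f t x) * (1 / f t x))) (at x)"
          if "t \<ge> 0" for t x
          using pos[OF that, of x] f1(1,2)[OF that, of x] by (auto intro!: derivative_eq_intros)
      qed
    qed
    show ?case by (intro exI[of _ D] conjI allI impI step D(1)) simp_all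
  qed
qed

lemma deriv_bounded_wave:
  assumes "times_diff n p" "\<And>j y. j \<le> n \<Longrightarrow> \<bar>(deriv ^^ j) p y\<bar> \<le> c * L ^ j" "\<bar>\<sigma>\<bar> \<le> 1" "L \<ge> 0"
  shows "deriv_bounded L n c (\<lambda>_ _. 1) (\<lambda>t x. p (x + \<sigma> * t))"
  using assms(1,2)
proof (induction n arbitrary: p c)
  case 0
  then show ?case by simp
next
  case (Suc n)
  note p = times_diff_SucD[OF Suc.prems(1)]
  have c: "c \<ge> 0" using Suc.prems(2)[of 0 0] by simp
  have dp: "\<bar>(deriv ^^ j) (deriv p) y\<bar> \<le> (c * L) * L ^ j" if "j \<le> n" for j y
    using Suc.prems(2)[of "Suc j" y] that by (simp add: funpow_Suc_right mult_ac del: funpow.simps)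
  have IH: "deriv_bounded L n (c * L) (\<lambda>_ _. 1) (\<lambda>t x. deriv p (x + \<sigma> * t))"
    by (rule Suc.IH[OF p(2) dp])
  show ?case
  proof (rule deriv_bounded_SucI[OF _ _ _ _ IH])
    show "\<bar>p (x + \<sigma> * t)\<bar> \<le> c * 1" for t x using Suc.prems(2)[of 0] by simp
    show "deriv_bounded L n (c * L) (\<lambda>_ _. 1) (\<lambda>t x. \<sigma> * deriv p (x + \<sigma> * t))"
      by (rule deriv_bounded_mono[OF deriv_bounded_cmult[OF IH]])
         (use c assms in \<open>auto intro: mult_left_le_one_le\<close>)
    show "((\<lambda>s. p (x + \<sigma> * s)) has_real_derivative \<sigma> * deriv p (x + \<sigma> * t)) (at t within {0..})" for t x
    proof -
      have "((\<lambda>s. x + \<sigma> * s) has_real_derivative \<sigma>) (at t within {0..})"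
        by (auto intro!: derivative_eq_intros)
      from DERIV_chain2[OF p(1) this] show ?thesis by (simp add: mult.commute)
    qed
    show "((\<lambda>x. p (x + \<sigma> * t)) has_real_derivative deriv p (x + \<sigma> * t)) (at x)" for t x
      by (rule shifted_deriv[OF Suc.prems(1)])
  qed
qed

text \<open>
  \<open>partial\<close> takes the \<open>x\<close>-derivatives first; peeling them off one by one leaves a function for
  which the same is done in \<open>t\<close>.
\<close>

lemma deriv_bounded_partial:
  assumes "deriv_bounded L (mi_order \<alpha>) c W f" "t \<ge> 0"
  shows "\<bar>partial \<alpha> f t x\<bar> \<le> c * L ^ mi_order \<alpha> * W t x"
proof -
  have dt: "deriv_bounded L m (c * L ^ k) W ((dt ^^ k) g)" if "deriv_bounded L (k + m) c W g" for k m c g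
    using that
  proof (induction k arbitrary: c g)
    case (Suc k)
    then show ?case using Suc.IH[of "c * L" "dt g"] by (simp add: funpow_Suc_right mult_ac del: funpow.simps)
  qed simp
  have dx: "deriv_bounded L m (c * L ^ k) W ((dx ^^ k) g)" if "deriv_bounded L (k + m) c W g" for k m c g
    using that
  proof (induction k arbitrary: c g)
    case (Suc k)
    then show ?case using Suc.IH[of "c * L" "dx g"] by (simp add: funpow_Suc_right mult_ac del: funpow.simps)
  qed simp
  have "deriv_bounded L (fst \<alpha>) (c * L ^ snd \<alpha>) W ((dx ^^ snd \<alpha>) f)"
    using assms(1) by (intro dx) (simp add: mi_order_def add.commute)
  then have "deriv_bounded L 0 (c * L ^ snd \<alpha> * L ^ fst \<alpha>) W (partial \<alpha> f)"
    unfolding partial_def by (intro dt) simp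
  then show ?thesis
    using assms(2) by (simp add: mi_order_def power_add mult_ac)
qed

section \<open>Characteristics and the perturbation of the background\<close>

text \<open>
  With \<open>\<sigma> = \<plusminus>1\<close>, the function \<open>R\<^sub>t + \<sigma> R\<^sub>x\<close> satisfies the transport equation with speed \<open>\<sigma>\<close>, by the
  wave equation and the symmetry of the mixed derivatives.
\<close>

lemma wave_characteristics:
  assumes R: "wave_solution R" and \<sigma>: "\<sigma> * \<sigma> = 1" and "t \<ge> 0"
  shows "dt R t x + \<sigma> * dx R t x = dt R 0 (x + \<sigma> * t) + \<sigma> * dx R 0 (x + \<sigma> * t)"
proof (rule transport[where gx = "\<lambda>t x. dx (dt R) t x + \<sigma> * dx (dx R) t x"])
  have C2: "C_k 2 R" and eq: "\<And>t x. t \<ge> 0 \<Longrightarrow> dt (dt R) t x = dx (dx R) t x"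
    using R by (auto simp: wave_solution_def)
  note R1 = C_k_SucD[OF C2[unfolded numeral_2_eq_2]]
  note Rt = C_k_SucD[OF R1(4)] and Rx = C_k_SucD[OF R1(5)]
  show "((\<lambda>s. dt R s x + \<sigma> * dx R s x) has_real_derivative
      \<sigma> * (dx (dt R) t x + \<sigma> * dx (dx R) t x)) (at t within {0..})" if "t \<ge> 0" for t x
  proof -
    have "((\<lambda>s. dt R s x + \<sigma> * dx R s x) has_real_derivative
        dt (dt R) t x + \<sigma> * dt (dx R) t x) (at t within {0..})"
      by (intro DERIV_add DERIV_cmult Rt(2) Rx(2) that)
    moreover have "dt (dt R) t x + \<sigma> * dt (dx R) t x = \<sigma> * (dx (dt R) t x + \<sigma> * dx (dx R) t x)"
      using eq[OF that] clairaut[OF C2 that] \<sigma> by (simp add: distrib_left mult.assoc[symmetric])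
    ultimately show ?thesis by simp
  qed
  show "((\<lambda>x. dt R t x + \<sigma> * dx R t x) has_real_derivative dx (dt R) t x + \<sigma> * dx (dx R) t x) (at x)"
    if "t \<ge> 0" for t x
    by (intro DERIV_add DERIV_cmult Rt(3) Rx(3) that)
  show "continuous_on ({0..} \<times> UNIV) (\<lambda>(t, x). dx (dt R) t x + \<sigma> * dx (dx R) t x)"
    using C_k_continuous[OF Rt(5)] C_k_continuous[OF Rx(5)]
    by (auto simp: case_prod_unfold intro!: continuous_intros)
qed fact

lemma R_b_derivs:
  "((\<lambda>s. a * exp (2 * s) * cosh (2 * x)) has_real_derivative (2 * a) * exp (2 * t) * cosh (2 * x)) (at t within A)"
  "((\<lambda>s. a * exp (2 * s) * sinh (2 * x)) has_real_derivative (2 * a) * exp (2 * t) * sinh (2 * x)) (at t within A)"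
  "((\<lambda>x. a * exp (2 * t) * cosh (2 * x)) has_real_derivative (2 * a) * exp (2 * t) * sinh (2 * x)) (at x)"
  "((\<lambda>x. a * exp (2 * t) * sinh (2 * x)) has_real_derivative (2 * a) * exp (2 * t) * cosh (2 * x)) (at x)"
  by (auto intro!: derivative_eq_intros)

lemma dt_R_b: "t \<ge> 0 \<Longrightarrow> dt (R_b R0) t x = (2 * R0) * exp (2 * t) * cosh (2 * x)"
  by (rule dt_eqI) (auto simp: R_b_def intro!: R_b_derivs)

lemma dx_R_b: "dx (R_b R0) t x = (2 * R0) * exp (2 * t) * sinh (2 * x)"
  by (rule dx_eqI) (auto simp: R_b_def intro!: R_b_derivs)

text \<open>
  D'Alembert's formula in differentiated form: \<open>u\<close> starts at \<open>h0\<close>, and its first derivatives are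
  the half sum and half difference of the profiles \<open>h1 + h0'\<close>, moving to the left, and
  \<open>h1 - h0'\<close>, moving to the right.  So \<open>h1\<close> is the initial velocity.
\<close>

definition dalembert_wave :: "(real \<Rightarrow> real) \<Rightarrow> (real \<Rightarrow> real) \<Rightarrow> (real \<Rightarrow> real \<Rightarrow> real) \<Rightarrow> bool" where
  "dalembert_wave h0 h1 u \<longleftrightarrow> u 0 = h0 \<and> (\<forall>x. (h0 has_real_derivative deriv h0 x) (at x)) \<and>
    (\<forall>t\<ge>0. \<forall>x.
      ((\<lambda>s. u s x) has_real_derivative
        (1/2 * h1 (x + t) + 1/2 * deriv h0 (x + t)) + (1/2 * h1 (x - t) + (-1/2) * deriv h0 (x - t))) (at t within {0..}) \<and>
      (u t has_real_derivative
        (1/2 * h1 (x + t) + 1/2 * deriv h0 (x + t)) - (1/2 * h1 (x - t) + (-1/2) * deriv h0 (x - t))) (at x))"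

text \<open>
  The solution \<open>R\<close> has the required form by the lemma on characteristics, and \<open>R\<^sub>b\<close> has it because
  \<open>\<partial>\<^sub>tR\<^sub>b \<plusminus> \<partial>\<^sub>xR\<^sub>b = 2 R\<^sub>0 e\<^sup>2\<^sup>t e\<^sup>\<plusminus>\<^sup>2\<^sup>x\<close> is a function of \<open>x \<plusminus> t\<close>; the perturbation is the difference.
\<close>

lemma dalembert_wave_perturbation:
  assumes R: "wave_solution R"
  shows "dalembert_wave (\<lambda>x. R 0 x - R_b R0 0 x) (\<lambda>x. dt R 0 x - dt (R_b R0) 0 x)
    (\<lambda>t x. R t x - R_b R0 t x)"
proof -
  define h0 where "h0 = (\<lambda>x. R 0 x - R_b R0 0 x)"
  define h1 where "h1 = (\<lambda>x. dt R 0 x - dt (R_b R0) 0 x)"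
  have "C_k (Suc 1) R" using R by (simp add: wave_solution_def numeral_2_eq_2)
  note R1 = C_k_SucD[OF this]
  have ut: "((\<lambda>s. R s x - R_b R0 s x) has_real_derivative dt R t x - dt (R_b R0) t x) (at t within {0..})"
    and ux: "((\<lambda>x. R t x - R_b R0 t x) has_real_derivative dx R t x - dx (R_b R0) t x) (at x)"
    if "t \<ge> 0" for t x
    using R1(2,3)[OF that] that unfolding dt_R_b[OF that] dx_R_b R_b_def
    by (auto intro!: DERIV_diff R_b_derivs)
  have h0: "(h0 has_real_derivative dx R 0 x - dx (R_b R0) 0 x) (at x)" for x
    unfolding h0_def using ux[of 0] by simp
  then have dh0: "deriv h0 x = dx R 0 x - dx (R_b R0) 0 x" for x by (rule DERIV_imp_deriv)
  have plus: "dt (R_b R0) t x + dx (R_b R0) t x = (2 * R0) * exp (2 * (x + t))" if "t \<ge> 0" for t x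
  proof -
    have "dt (R_b R0) t x + dx (R_b R0) t x = (2 * R0) * (exp (2 * t) * (cosh (2 * x) + sinh (2 * x)))"
      unfolding dt_R_b[OF that] dx_R_b by (simp only: distrib_left mult.assoc)
    then show ?thesis by (simp add: cosh_plus_sinh exp_add[symmetric] add.commute)
  qed
  have minus: "dt (R_b R0) t x - dx (R_b R0) t x = (2 * R0) * exp (- 2 * (x - t))" if "t \<ge> 0" for t x
  proof -
    have "dt (R_b R0) t x - dx (R_b R0) t x = (2 * R0) * (exp (2 * t) * (cosh (2 * x) - sinh (2 * x)))"
      unfolding dt_R_b[OF that] dx_R_b by (simp only: right_diff_distrib mult.assoc)
    then show ?thesis by (simp add: cosh_minus_sinh exp_add[symmetric])
  qed
  have b: "dt (R_b R0) t x + dx (R_b R0) t x = dt (R_b R0) 0 (x + t) + dx (R_b R0) 0 (x + t)"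
    "dt (R_b R0) t x - dx (R_b R0) t x = dt (R_b R0) 0 (x - t) - dx (R_b R0) 0 (x - t)" if "t \<ge> 0" for t x
    using plus[OF that] minus[OF that] plus[of 0] minus[of 0] by simp_all
  have w: "dt R t x + dx R t x = dt R 0 (x + t) + dx R 0 (x + t)"
    "dt R t x - dx R t x = dt R 0 (x - t) - dx R 0 (x - t)" if "t \<ge> 0" for t x
  proof -
    have "(-1) * (-1) = (1::real)" by simp
    from wave_characteristics[OF R this that, of x] wave_characteristics[OF R mult_1 that, of x]
    show "dt R t x + dx R t x = dt R 0 (x + t) + dx R 0 (x + t)"
      "dt R t x - dx R t x = dt R 0 (x - t) - dx R 0 (x - t)"
      by (simp_all only: mult_1 mult_minus1 add_uminus_conv_diff)
  qed
  have eqs: "dt R t x - dt (R_b R0) t x =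
      (1/2 * h1 (x + t) + 1/2 * deriv h0 (x + t)) + (1/2 * h1 (x - t) + (-1/2) * deriv h0 (x - t))"
    "dx R t x - dx (R_b R0) t x =
      (1/2 * h1 (x + t) + 1/2 * deriv h0 (x + t)) - (1/2 * h1 (x - t) + (-1/2) * deriv h0 (x - t))"
    if "t \<ge> 0" for t x
    unfolding dh0 h1_def using w[OF that, of x] b[OF that, of x] by (simp_all add: field_simps)
  show ?thesis
    unfolding dalembert_wave_def h0_def[symmetric] h1_def[symmetric]
  proof (intro conjI allI impI refl)
    show "(h0 has_real_derivative deriv h0 x) (at x)" for x using h0[of x] dh0[of x] by simp
  qed (simp_all only: eqs[symmetric] ut ux)
qed

text \<open>
  The function \<open>\<psi>\<close> in the proof is the part of d'Alembert's formula that comes from the initial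
  velocity.  Its time derivative is the mean of \<open>h1\<close> at \<open>x + s\<close> and \<open>x - s\<close>, where the derivatives
  of \<open>h0\<close> have cancelled, so that the bound is free of \<open>h0'\<close>.
\<close>

lemma dalembert_wave_bound:
  assumes u: "dalembert_wave h0 h1 u" and h0: "\<And>x. \<bar>h0 x\<bar> \<le> a" and h1: "\<And>x. \<bar>h1 x\<bar> \<le> b" and "t \<ge> 0"
  shows "\<bar>u t x\<bar> \<le> a + t * b"
proof -
  define \<psi> where "\<psi> s = u s x - 1/2 * h0 (x + s) - 1/2 * h0 (x - s)" for s
  have d0: "(h0 has_real_derivative deriv h0 y) (at y)" for y
    using u by (simp add: dalembert_wave_def)
  have "(\<psi> has_real_derivative (1/2 * h1 (x + s) + 1/2 * h1 (x - s))) (at s within {0..t})"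
    if "s \<in> {0..t}" for s
  proof -
    have "((\<lambda>s. u s x) has_real_derivative
        (1/2 * h1 (x + s) + 1/2 * deriv h0 (x + s)) + (1/2 * h1 (x - s) + (-1/2) * deriv h0 (x - s)))
      (at s within {0..t})"
      using u that by (intro DERIV_subset[where t="{0..t}" and s="{0..}"]) (auto simp: dalembert_wave_def)
    moreover have "((\<lambda>s. h0 (x + s)) has_real_derivative deriv h0 (x + s) * 1) (at s within {0..t})"
      by (rule DERIV_chain2[OF d0]) (auto intro!: derivative_eq_intros)
    moreover have "((\<lambda>s. h0 (x - s)) has_real_derivative deriv h0 (x - s) * (-1)) (at s within {0..t})"
      by (rule DERIV_chain2[OF d0]) (auto intro!: derivative_eq_intros)
    ultimately show ?thesis
      unfolding \<psi>_def by (auto intro!: derivative_eq_intros)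
  qed
  moreover have "norm (1/2 * h1 (x + s) + 1/2 * h1 (x - s)) \<le> b" for s
    using h1[of "x + s"] h1[of "x - s"] by simp
  ultimately have "norm (\<psi> t - \<psi> 0) \<le> b * norm (t - 0)"
    using \<open>t \<ge> 0\<close> by (intro field_differentiable_bound[of "{0..t}" \<psi>]) auto
  moreover have "\<psi> 0 = 0" using u by (simp add: \<psi>_def dalembert_wave_def)
  ultimately show ?thesis
    using h0[of "x + t"] h0[of "x - t"] \<open>t \<ge> 0\<close> by (simp add: \<psi>_def mult.commute)
qed

text \<open>
  The first derivatives of \<open>u\<close> are combinations of travelling waves, whose derivatives in \<open>t\<close> and in
  \<open>x\<close> are those of the profile up to sign.  No growth in time occurs: the weight is 1.
\<close>

lemma dalembert_wave_dt_dx_bounded: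
  assumes u: "dalembert_wave h0 h1 u" and h0: "times_diff (Suc k) h0" and h1: "times_diff k h1"
    and h0_le: "\<And>j y. j \<le> k \<Longrightarrow> \<bar>(deriv ^^ Suc j) h0 y\<bar> \<le> a * L ^ j"
    and h1_le: "\<And>j y. j \<le> k \<Longrightarrow> \<bar>(deriv ^^ j) h1 y\<bar> \<le> b * L ^ j" and L: "L \<ge> 0"
  shows "deriv_bounded L k (a + b) (\<lambda>_ _. 1) (dt u)" "deriv_bounded L k (a + b) (\<lambda>_ _. 1) (dx u)"
proof -
  define p where "p = (\<lambda>y. 1/2 * h1 y + 1/2 * deriv h0 y)"
  define q where "q = (\<lambda>y. 1/2 * h1 y + (-1/2) * deriv h0 y)"
  have dh0: "times_diff k (deriv h0)" using times_diff_SucD[OF h0] by simp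
  have comb: "\<bar>(deriv ^^ j) (\<lambda>y. 1/2 * h1 y + e * deriv h0 y) y\<bar> \<le> ((a + b) / 2) * L ^ j"
    if "j \<le> k" "\<bar>e\<bar> = 1/2" for j y e
  proof -
    have "\<bar>1/2 * (deriv ^^ j) h1 y + e * (deriv ^^ j) (deriv h0) y\<bar>
        \<le> 1/2 * \<bar>(deriv ^^ j) h1 y\<bar> + \<bar>e\<bar> * \<bar>(deriv ^^ j) (deriv h0) y\<bar>"
      by (rule order_trans[OF abs_triangle_ineq]) (simp add: abs_mult)
    also have "\<dots> \<le> ((a + b) / 2) * L ^ j"
      unfolding that(2) using h0_le[OF that(1), of y] h1_le[OF that(1), of y]
      by (simp add: funpow_Suc_right algebra_simps del: funpow.simps)
    finally show ?thesis using higher_deriv_lincomb(2)[OF h1 dh0 that(1), of "1/2" e] by simp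
  qed
  have p: "deriv_bounded L k ((a + b) / 2) (\<lambda>_ _. 1) (\<lambda>t x. p (x + 1 * t))"
    unfolding p_def
    by (rule deriv_bounded_wave[OF higher_deriv_lincomb(1)[OF h1 dh0] comb _ L]) simp_all
  have q: "deriv_bounded L k ((a + b) / 2) (\<lambda>_ _. 1) (\<lambda>t x. q (x + (-1) * t))"
    unfolding q_def
    by (rule deriv_bounded_wave[OF higher_deriv_lincomb(1)[OF h1 dh0] comb _ L]) simp_all
  have "dt u t x = p (x + 1 * t) + q (x + (-1) * t)" if "t \<ge> 0" for t x
    using u that by (intro dt_eqI) (auto simp: dalembert_wave_def p_def q_def)
  then show "deriv_bounded L k (a + b) (\<lambda>_ _. 1) (dt u)"
    using deriv_bounded_add[OF p q] by (auto elim!: deriv_bounded_cong)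
  have "dx u t x = p (x + t) - q (x - t)" if "t \<ge> 0" for t x
    using u that unfolding p_def q_def by (intro dx_eqI) (simp only: dalembert_wave_def)
  then have "dx u t x = p (x + 1 * t) + (-1) * q (x + (-1) * t)" if "t \<ge> 0" for t x
    using that by simp
  then show "deriv_bounded L k (a + b) (\<lambda>_ _. 1) (dx u)"
    using deriv_bounded_add[OF p deriv_bounded_cmult[OF q, of "-1"]] by (auto elim!: deriv_bounded_cong)
qed

text \<open>
  For \<open>u\<close> itself the weight \<open>1 + t\<close> accounts for the linear growth, which its derivatives do not
  have.
\<close>

lemma dalembert_wave_bounded:
  assumes u: "dalembert_wave h0 h1 u"
    and "deriv_bounded L k s (\<lambda>_ _. 1) (dt u)" "deriv_bounded L k s (\<lambda>_ _. 1) (dx u)"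
    and "\<And>t x. t \<ge> 0 \<Longrightarrow> \<bar>u t x\<bar> \<le> d * (1 + t)" "s \<le> d * L" "0 \<le> d" "0 \<le> L"
  shows "deriv_bounded L (Suc k) d (\<lambda>t _. 1 + t) u"
proof -
  have "deriv_bounded L k (d * L) (\<lambda>t _. 1 + t) (dt u)" "deriv_bounded L k (d * L) (\<lambda>t _. 1 + t) (dx u)"
    by (rule deriv_bounded_mono[OF assms(2)] deriv_bounded_mono[OF assms(3)]; use assms(5-7) in simp)+
  moreover have "(\<lambda>s. u s x) differentiable at t within {0..}" "u t differentiable at x" if "t \<ge> 0" for t x
    using u that unfolding dalembert_wave_def real_differentiable_def by blast+
  ultimately show ?thesis using assms(4) by simp
qed

text \<open>
  Differentiation in \<open>x\<close> exchanges the two functions, up to the factor 2; hence both are treated in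
  one induction.
\<close>

lemma R_b_deriv_bounded:
  assumes "L \<ge> 1"
  shows "deriv_bounded L n (\<bar>a\<bar> * 2 ^ n) (\<lambda>t x. exp (2 * t) * cosh (2 * x)) (\<lambda>t x. a * exp (2 * t) * cosh (2 * x))"
    "deriv_bounded L n (\<bar>a\<bar> * 2 ^ n) (\<lambda>t x. exp (2 * t) * cosh (2 * x)) (\<lambda>t x. a * exp (2 * t) * sinh (2 * x))"
proof -
  have sinh_le: "\<bar>sinh y\<bar> \<le> cosh y" for y :: real
    unfolding sinh_def cosh_def by (simp add: abs_le_iff)
  have b: "\<bar>a * exp (2 * t) * cosh (2 * x)\<bar> \<le> (\<bar>a\<bar> * 2 ^ n) * (exp (2 * t) * cosh (2 * x))"
    "\<bar>a * exp (2 * t) * sinh (2 * x)\<bar> \<le> (\<bar>a\<bar> * 2 ^ n) * (exp (2 * t) * cosh (2 * x))" for a t x :: real and n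
  proof -
    have "\<bar>a\<bar> * exp (2 * t) * cosh (2 * x) * 1 \<le> \<bar>a\<bar> * exp (2 * t) * cosh (2 * x) * 2 ^ n"
      by (intro mult_left_mono one_le_power) (auto simp: cosh_real_nonneg)
    moreover have "\<bar>a\<bar> * exp (2 * t) * \<bar>sinh (2 * x)\<bar> \<le> \<bar>a\<bar> * exp (2 * t) * cosh (2 * x)"
      by (intro mult_left_mono sinh_le) auto
    ultimately show "\<bar>a * exp (2 * t) * cosh (2 * x)\<bar> \<le> (\<bar>a\<bar> * 2 ^ n) * (exp (2 * t) * cosh (2 * x))"
      "\<bar>a * exp (2 * t) * sinh (2 * x)\<bar> \<le> (\<bar>a\<bar> * 2 ^ n) * (exp (2 * t) * cosh (2 * x))"
      by (simp_all add: abs_mult cosh_real_nonneg mult_ac)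
  qed
  have "deriv_bounded L n (\<bar>a\<bar> * 2 ^ n) (\<lambda>t x. exp (2 * t) * cosh (2 * x)) (\<lambda>t x. a * exp (2 * t) * cosh (2 * x)) \<and>
    deriv_bounded L n (\<bar>a\<bar> * 2 ^ n) (\<lambda>t x. exp (2 * t) * cosh (2 * x)) (\<lambda>t x. a * exp (2 * t) * sinh (2 * x))"
  proof (induction n arbitrary: a)
    case 0
    show ?case using b[of _ _ _ 0] by simp
  next
    case (Suc n)
    have m: "deriv_bounded L n (\<bar>a\<bar> * 2 ^ Suc n * L) (\<lambda>t x. exp (2 * t) * cosh (2 * x)) f"
      if f: "deriv_bounded L n (\<bar>2 * a\<bar> * 2 ^ n) (\<lambda>t x. exp (2 * t) * cosh (2 * x)) f" for f
    proof (rule deriv_bounded_mono[OF f])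
      show "\<bar>2 * a\<bar> * 2 ^ n \<le> \<bar>a\<bar> * 2 ^ Suc n * L"
        using mult_left_mono[OF assms, of "\<bar>a\<bar> * 2 ^ Suc n"] by (simp add: abs_mult mult_ac)
    qed (use assms in \<open>auto simp: cosh_real_nonneg\<close>)
    note IH = m[OF conjunct1[OF Suc.IH[of "2 * a"]]] m[OF conjunct2[OF Suc.IH[of "2 * a"]]]
    show ?case
      by (intro conjI deriv_bounded_SucI[OF b(1) R_b_derivs(1) R_b_derivs(3) IH(1) IH(2)]
          deriv_bounded_SucI[OF b(2) R_b_derivs(2) R_b_derivs(4) IH(2) IH(1)])
  qed
  then show "deriv_bounded L n (\<bar>a\<bar> * 2 ^ n) (\<lambda>t x. exp (2 * t) * cosh (2 * x)) (\<lambda>t x. a * exp (2 * t) * cosh (2 * x))"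
    "deriv_bounded L n (\<bar>a\<bar> * 2 ^ n) (\<lambda>t x. exp (2 * t) * cosh (2 * x)) (\<lambda>t x. a * exp (2 * t) * sinh (2 * x))"
    by auto
qed

lemma one_plus_le_exp_cosh:
  assumes "(t::real) \<ge> 0"
  shows "1 + t \<le> exp (2 * t)" "exp (2 * t) \<le> exp (2 * t) * cosh (2 * x)" "1 + t \<le> exp (2 * t) * cosh (2 * x)"
proof -
  show 1: "1 + t \<le> exp (2 * t)" using exp_ge_add_one_self[of "2 * t"] assms by linarith
  show 2: "exp (2 * t) \<le> exp (2 * t) * cosh (2 * x)"
    using mult_left_mono[OF cosh_real_ge_1, of "exp (2 * t)" "2 * x"] by simp
  show "1 + t \<le> exp (2 * t) * cosh (2 * x)" using 1 2 by linarith
qed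

section \<open>The quotients\<close>

text \<open>
  With \<open>R = R\<^sub>b + u\<close>, \<open>f = u\<^sub>z\<close> and \<open>b = (R\<^sub>b)\<^sub>z\<close>, where \<open>z\<close> is \<open>t\<close> or \<open>x\<close>, the function in the
  conclusion is \<open>R\<^sub>z/R - (R\<^sub>b)\<^sub>z/R\<^sub>b = u\<^sub>z/R - ((R\<^sub>b)\<^sub>z/R\<^sub>b) (u/R)\<close>.  Each term has exactly one factor
  that is small of size \<open>S\<close>.  The other occurrences of \<open>u\<close> sit inside \<open>1/R\<close>, for which the bound
  on \<open>u\<close> without \<open>S\<close> is used; together with \<open>R \<ge> R\<^sub>b/3\<close> it makes \<open>1/R\<close> bounded with weight
  \<open>1/E\<close>, where \<open>E = e\<^sup>2\<^sup>t cosh 2x\<close>.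
\<close>

lemma quotient_remainder_bounded:
  assumes "R0 > 0" "c \<ge> 0" "B \<ge> 0"
  shows "\<exists>C>0. \<forall>L\<ge>1. \<forall>S\<ge>0. \<forall>u f b.
    deriv_bounded L k c (\<lambda>t _. 1 + t) u \<longrightarrow>
    deriv_bounded L k (c * S) (\<lambda>t _. 1 + t) u \<longrightarrow>
    deriv_bounded L k (c * S) (\<lambda>t _. 1 + t) f \<longrightarrow>
    deriv_bounded L k B (\<lambda>t x. exp (2 * t) * cosh (2 * x)) b \<longrightarrow>
    (\<forall>t\<ge>0. \<forall>x. R_b R0 t x + u t x \<ge> R0 / 3 * (exp (2 * t) * cosh (2 * x))) \<longrightarrow>
    deriv_bounded L k (C * S) (\<lambda>t x. (1 + t) / (exp (2 * t) * cosh (2 * x)))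
      (\<lambda>t x. f t x * (1 / (R_b R0 t x + u t x)) +
        (-1) * (b t x * (1 / R_b R0 t x) * u t x * (1 / (R_b R0 t x + u t x))))"
proof -
  define E where "E = (\<lambda>t x::real. exp (2 * t) * cosh (2 * x))"
  define B0 where "B0 = \<bar>R0\<bar> * 2 ^ k"
  have E_pos: "E t x > 0" for t x by (simp add: E_def cosh_real_pos)
  have B0: "B0 \<ge> 0" by (simp add: B0_def)
  obtain K where K: "K \<ge> 0" and K_all: "\<forall>L\<ge>0. \<forall>E f. (\<forall>t\<ge>0. \<forall>x. E t x > 0 \<and> f t x \<ge> R0 / 3 * E t x) \<longrightarrow>
      deriv_bounded L k (B0 + c) E f \<longrightarrow> deriv_bounded L k K (\<lambda>t x. 1 / E t x) (\<lambda>t x. 1 / f t x)"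
    using deriv_bounded_inverse[of "B0 + c" "R0 / 3" k] assms B0 by auto
  define C where "C = 2 ^ k * c * K + 2 ^ k * (2 ^ k * (2 ^ k * B * K) * c) * K + 1"
  have C: "C > 0"
    unfolding C_def using assms K by (intro add_nonneg_pos add_nonneg_nonneg mult_nonneg_nonneg) auto
  have "deriv_bounded L k (C * S) (\<lambda>t x. (1 + t) / E t x)
      (\<lambda>t x. f t x * (1 / (R_b R0 t x + u t x)) +
        (-1) * (b t x * (1 / R_b R0 t x) * u t x * (1 / (R_b R0 t x + u t x))))"
    if L: "L \<ge> 1" and S: "S \<ge> 0" and u: "deriv_bounded L k c (\<lambda>t _. 1 + t) u"
      and uS: "deriv_bounded L k (c * S) (\<lambda>t _. 1 + t) u" and f: "deriv_bounded L k (c * S) (\<lambda>t _. 1 + t) f"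
      and b: "deriv_bounded L k B E b"
      and pos: "\<forall>t\<ge>0. \<forall>x. R_b R0 t x + u t x \<ge> R0 / 3 * E t x" for L S u f b
  proof -
    have R_b: "deriv_bounded L k B0 E (R_b R0)"
      using R_b_deriv_bounded(1)[OF L, of k R0] unfolding E_def B0_def R_b_def[abs_def] .
    have "deriv_bounded L k c E u"
      by (rule deriv_bounded_mono[OF u]) (use L assms one_plus_le_exp_cosh in \<open>auto simp: E_def\<close>)
    then have R: "deriv_bounded L k (B0 + c) E (\<lambda>t x. R_b R0 t x + u t x)"
      by (rule deriv_bounded_add[OF R_b])
    have L0: "L \<ge> 0" using L by simp
    have inv: "deriv_bounded L k K (\<lambda>t x. 1 / E t x) (\<lambda>t x. 1 / (R_b R0 t x + u t x))"
      by (rule K_all[rule_format, OF L0 _ R]) (use pos E_pos in auto)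
    have "deriv_bounded L k (B0 + c) E (R_b R0)"
      by (rule deriv_bounded_mono[OF R_b]) (use L0 assms B0 E_pos in \<open>auto simp: less_imp_le\<close>)
    moreover have "R_b R0 t x \<ge> R0 / 3 * E t x" for t x
      using mult_pos_pos[OF assms(1) E_pos[of t x]] by (simp add: R_b_def E_def mult_ac)
    ultimately have inv_b: "deriv_bounded L k K (\<lambda>t x. 1 / E t x) (\<lambda>t x. 1 / R_b R0 t x)"
      by (intro K_all[rule_format, OF L0]) (use E_pos in auto)
    have 1: "deriv_bounded L k (2 ^ k * (c * S) * K) (\<lambda>t x. (1 + t) / E t x)
        (\<lambda>t x. f t x * (1 / (R_b R0 t x + u t x)))"
      by (rule deriv_bounded_mono[OF deriv_bounded_mult[OF f inv]])
         (use L0 assms K S E_pos in \<open>auto simp: less_imp_le\<close>)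
    have 2: "deriv_bounded L k (2 ^ k * (2 ^ k * (2 ^ k * B * K) * (c * S)) * K) (\<lambda>t x. (1 + t) / E t x)
        (\<lambda>t x. b t x * (1 / R_b R0 t x) * u t x * (1 / (R_b R0 t x + u t x)))"
      by (rule deriv_bounded_mono[OF deriv_bounded_mult[OF deriv_bounded_mult[OF deriv_bounded_mult[OF b inv_b] uS] inv]])
         (use L0 assms K S E_pos in \<open>auto simp: less_imp_le less_imp_neq[THEN not_sym]\<close>)
    show ?thesis
    proof (rule deriv_bounded_mono[OF deriv_bounded_add[OF 1 deriv_bounded_cmult[OF 2, of "-1"]]])
      show "2 ^ k * (c * S) * K + \<bar>- 1\<bar> * (2 ^ k * (2 ^ k * (2 ^ k * B * K) * (c * S)) * K) \<le> C * S"
        using S by (simp add: C_def algebra_simps)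
    qed (use C S L0 E_pos in \<open>auto simp: less_imp_le\<close>)
  qed
  then show ?thesis using C unfolding E_def by (intro exI[of _ C] conjI allI impI) simp_all
qed

text \<open>
  The choice of the scale \<open>L\<close> and the size \<open>S\<close>.  Here \<open>M\<close> stands for the norm of order \<open>k + 1\<close> of the
  data, which may be large, while the data themselves are bounded by the fixed number \<open>A\<close>.
  The total \<open>S L\<^sup>k\<close> must be at most \<open>M\<close>, with \<open>c\<close> independent of \<open>M\<close>.  If \<open>M \<le> 1\<close>, take
  \<open>L = 1\<close> and \<open>S = M\<close>.  If \<open>M > 1\<close>, take \<open>S = L = M\<^sup>1\<^sup>/\<^sup>(\<^sup>k\<^sup>+\<^sup>1\<^sup>)\<close>, for which interpolation bounds the
  \<open>j\<close>-th derivative of \<open>h0\<close> by \<open>L\<^sup>j\<close> and that of \<open>h1\<close> by \<open>L\<^sup>j\<^sup>+\<^sup>1\<close>, up to constants.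
\<close>

lemma interpolated_data:
  assumes "A \<ge> 0"
  shows "\<exists>c\<ge>1. \<forall>h0 h1 M. times_diff (Suc k) h0 \<longrightarrow> times_diff k h1 \<longrightarrow>
    (\<forall>y. \<bar>h0 y\<bar> \<le> A) \<longrightarrow> (\<forall>y. \<bar>h1 y\<bar> \<le> A) \<longrightarrow>
    (\<forall>j\<le>Suc k. \<forall>y. \<bar>(deriv ^^ j) h0 y\<bar> \<le> M) \<longrightarrow> (\<forall>j\<le>k. \<forall>y. \<bar>(deriv ^^ j) h1 y\<bar> \<le> M) \<longrightarrow>
    (\<exists>L\<ge>1. \<exists>S\<ge>0. S \<le> L \<and> S * L ^ k \<le> M \<and> (\<forall>y. \<bar>h0 y\<bar> \<le> c * S) \<and>
      (\<forall>j\<le>k. \<forall>y. \<bar>(deriv ^^ Suc j) h0 y\<bar> \<le> c * S * L ^ j \<and> \<bar>(deriv ^^ j) h1 y\<bar> \<le> c * S * L ^ j))"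
proof -
  obtain C0 where C0: "C0 \<ge> 0" "\<forall>h A B L j. times_diff (Suc k) h \<longrightarrow> L > 0 \<longrightarrow> (\<forall>y. \<bar>h y\<bar> \<le> A) \<longrightarrow>
     (\<forall>y. \<bar>(deriv ^^ Suc k) h y\<bar> \<le> B * L ^ Suc k) \<longrightarrow> j \<le> Suc k \<longrightarrow> (\<forall>y. \<bar>(deriv ^^ j) h y\<bar> \<le> C0 * (A + B) * L ^ j)"
    using interpolation[of "Suc k"] by blast
  obtain C1 where C1: "C1 \<ge> 0" "\<forall>h A B L j. times_diff k h \<longrightarrow> L > 0 \<longrightarrow> (\<forall>y. \<bar>h y\<bar> \<le> A) \<longrightarrow>
     (\<forall>y. \<bar>(deriv ^^ k) h y\<bar> \<le> B * L ^ k) \<longrightarrow> j \<le> k \<longrightarrow> (\<forall>y. \<bar>(deriv ^^ j) h y\<bar> \<le> C1 * (A + B) * L ^ j)"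
    using interpolation[of k] by blast
  define c where "c = (C0 + C1 + 1) * (A + 1)"
  have c_ge: "C0 * (A + 1) \<le> c" "C1 * (A + 1) \<le> c" "A \<le> c" "1 \<le> c"
    using C0(1) C1(1) assms by (auto simp: c_def distrib_right)
  have "\<exists>L\<ge>1. \<exists>S\<ge>0. S \<le> L \<and> S * L ^ k \<le> M \<and> (\<forall>y. \<bar>h0 y\<bar> \<le> c * S) \<and>
      (\<forall>j\<le>k. \<forall>y. \<bar>(deriv ^^ Suc j) h0 y\<bar> \<le> c * S * L ^ j \<and> \<bar>(deriv ^^ j) h1 y\<bar> \<le> c * S * L ^ j)"
    if h0: "times_diff (Suc k) h0" and h1: "times_diff k h1"
      and A0: "\<And>y. \<bar>h0 y\<bar> \<le> A" and A1: "\<And>y. \<bar>h1 y\<bar> \<le> A"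
      and M0: "\<And>j y. j \<le> Suc k \<Longrightarrow> \<bar>(deriv ^^ j) h0 y\<bar> \<le> M"
      and M1: "\<And>j y. j \<le> k \<Longrightarrow> \<bar>(deriv ^^ j) h1 y\<bar> \<le> M" for h0 h1 M
  proof (cases "M \<le> 1")
    case True
    have "M \<ge> 0" using M0[of 0 0] by simp
    then have "M \<le> c * M" using mult_right_mono[OF c_ge(4), of M] by simp
    then have "\<bar>h0 y\<bar> \<le> c * M" "j \<le> k \<Longrightarrow> \<bar>(deriv ^^ Suc j) h0 y\<bar> \<le> c * M"
      "j \<le> k \<Longrightarrow> \<bar>(deriv ^^ j) h1 y\<bar> \<le> c * M" for j y
      using M0[of 0 y] M0[of "Suc j" y] M1[of j y] by auto
    then show ?thesis
      using True \<open>M \<ge> 0\<close> by (intro exI[of _ 1] exI[of _ M] conjI allI impI) simp_all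
  next
    case False
    define L where "L = root (Suc k) M"
    have L: "L \<ge> 1" using False by (simp add: L_def)
    have LM: "L ^ Suc k = M" unfolding L_def by (rule real_root_pow_pos2) (use False in auto)
    have le0: "\<bar>(deriv ^^ j) h0 y\<bar> \<le> c * L ^ j" if "j \<le> Suc k" for j y
    proof -
      have "\<bar>(deriv ^^ j) h0 y\<bar> \<le> C0 * (A + 1) * L ^ j"
      proof (rule C0(2)[rule_format, OF h0 _ A0 _ that])
        show "\<bar>(deriv ^^ Suc k) h0 y\<bar> \<le> 1 * L ^ Suc k" for y
          using M0[of "Suc k" y] unfolding LM by simp
      qed (use L in auto)
      also have "\<dots> \<le> c * L ^ j" using c_ge(1) L by (intro mult_right_mono) auto
      finally show ?thesis .
    qed
    have le1: "\<bar>(deriv ^^ j) h1 y\<bar> \<le> c * L * L ^ j" if "j \<le> k" for j y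
    proof -
      \<comment> \<open>the top derivative of \<open>h1\<close> has order \<open>k\<close> only, so \<open>M = L L\<^sup>k\<close> is read with \<open>B = L\<close>\<close>
      have "\<bar>(deriv ^^ j) h1 y\<bar> \<le> C1 * (A + L) * L ^ j"
      proof (rule C1(2)[rule_format, OF h1 _ A1 _ that])
        show "\<bar>(deriv ^^ k) h1 y\<bar> \<le> L * L ^ k" for y
          using M1[of k y] unfolding LM[symmetric] by simp
      qed (use L in auto)
      also have "\<dots> \<le> C1 * ((A + 1) * L) * L ^ j"
      proof -
        have "A + L \<le> (A + 1) * L" using mult_left_mono[OF L assms] by (simp add: distrib_right)
        then show ?thesis using C1(1) L by (intro mult_right_mono mult_left_mono) auto
      qed
      also have "\<dots> \<le> c * L * L ^ j"
        using mult_right_mono[OF c_ge(2), of L] L by (intro mult_right_mono) (auto simp: mult_ac)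
      finally show ?thesis .
    qed
    show ?thesis
    proof (intro exI[of _ L] conjI allI impI)
      show "L * L ^ k \<le> M" using LM by simp
      show "\<bar>h0 y\<bar> \<le> c * L" for y
      proof -
        have "c * 1 \<le> c * L" using L c_ge(4) by (intro mult_left_mono) auto
        then show ?thesis using A0[of y] c_ge(3) by linarith
      qed
      show "\<bar>(deriv ^^ Suc j) h0 y\<bar> \<le> c * L * L ^ j" if "j \<le> k" for j y
        using le0[of "Suc j" y] that by (simp add: mult.assoc)
      show "\<bar>(deriv ^^ j) h1 y\<bar> \<le> c * L * L ^ j" if "j \<le> k" for j y by (rule le1[OF that])
    qed (use L in auto)
  qed
  then show ?thesis using c_ge(4) by (intro exI[where x=c]) simp
qed

text \<open>
  The perturbation is at most \<open>(1 + t) 2R\<^sub>0/3\<close>, and \<open>1 + t \<le> e\<^sup>2\<^sup>t cosh 2x\<close>; so at least a third of the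
  background survives.
\<close>

lemma perturbed_background_pos:
  assumes "R0 > 0" "a + b \<le> 2 * R0 / 3" "a \<ge> 0" "b \<ge> 0" "t \<ge> 0" "\<bar>v\<bar> \<le> a + t * b"
  shows "R_b R0 t x + v \<ge> R0 / 3 * (exp (2 * t) * cosh (2 * x))"
proof -
  have "\<bar>v\<bar> \<le> (1 + t) * (a + b)"
  proof -
    have "(1 + t) * (a + b) = (a + t * b) + (b + t * a)" by (simp add: algebra_simps)
    moreover have "0 \<le> b + t * a" using assms by simp
    ultimately show ?thesis using assms(6) by linarith
  qed
  also have "\<dots> \<le> (exp (2 * t) * cosh (2 * x)) * (2 * R0 / 3)"
    using one_plus_le_exp_cosh(3)[OF assms(5)] assms by (intro mult_mono) auto
  finally show ?thesis by (simp add: R_b_def field_simps)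
qed

lemma C_k_times_diff: "C_k n f \<Longrightarrow> t \<ge> 0 \<Longrightarrow> times_diff n (f t)"
proof (induction n arbitrary: f)
  case (Suc n)
  note f = C_k_SucD[OF Suc.prems(1)]
  show ?case by (rule times_diff_SucI[OF f(3)[OF Suc.prems(2)] Suc.IH[OF f(5) Suc.prems(2)]])
qed simp

lemma times_diff_cosh: "times_diff n (\<lambda>x. a * exp (2 * t) * cosh (2 * x))"
proof -
  have "times_diff n (\<lambda>x. a * exp (2 * t) * cosh (2 * x)) \<and> times_diff n (\<lambda>x. a * exp (2 * t) * sinh (2 * x))"
  proof (induction n arbitrary: a)
    case (Suc n)
    show ?case
      using times_diff_SucI[OF R_b_derivs(3) conjunct2[OF Suc.IH]]
        times_diff_SucI[OF R_b_derivs(4) conjunct1[OF Suc.IH]] by blast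
  qed simp
  then show ?thesis by blast
qed

lemma perturbation_data_times_diff:
  assumes "C_k (Suc k) R"
  shows "times_diff (Suc k) (\<lambda>x. R 0 x - R_b R0 0 x)"
    "times_diff k (\<lambda>x. dt R 0 x - dt (R_b R0) 0 x)"
proof -
  have "times_diff (Suc k) (\<lambda>x. 1 * R 0 x + (-1) * R_b R0 0 x)"
    unfolding R_b_def using C_k_times_diff[OF assms, of 0]
    by (intro higher_deriv_lincomb(1) times_diff_cosh) simp
  then show "times_diff (Suc k) (\<lambda>x. R 0 x - R_b R0 0 x)" by simp
  have "times_diff k (\<lambda>x. 1 * dt R 0 x + (-1) * dt (R_b R0) 0 x)"
    unfolding dt_R_b[OF order_refl] using C_k_times_diff[OF C_k_SucD(4)[OF assms], of 0]
    by (intro higher_deriv_lincomb(1) times_diff_cosh) simp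
  then show "times_diff k (\<lambda>x. dt R 0 x - dt (R_b R0) 0 x)" by simp
qed

section \<open>Norms of the initial data\<close>

lemma C_k_norm_le_iff: "C_k_norm k g \<le> ereal a \<longleftrightarrow> (\<forall>j\<le>k. \<forall>x. \<bar>(deriv ^^ j) g x\<bar> \<le> a)"
  by (auto simp: C_k_norm_def sup_norm_def SUP_le_iff)

lemma C_k_norm_nonneg: "0 \<le> C_k_norm k g"
proof -
  have "ereal \<bar>g 0\<bar> \<le> sup_norm ((deriv ^^ 0) g)"
    unfolding sup_norm_def by (auto intro: SUP_upper2[where i=0])
  also have "\<dots> \<le> C_k_norm k g" unfolding C_k_norm_def by (rule SUP_upper) simp
  finally show ?thesis by (rule order_trans[rotated]) simp
qed

lemma m_norm_eq: "m_norm R0 R k t =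
    C_k_norm k (\<lambda>x. R t x - R_b R0 t x) + C_k_norm (k - 1) (\<lambda>x. dt R t x - dt (R_b R0) t x)"
  by (cases k) simp_all

lemma m_norm_finite:
  assumes "m_norm R0 R k 0 \<noteq> \<infinity>"
  shows "\<exists>a\<ge>0. \<exists>b\<ge>0. m_norm R0 R k 0 = ereal (a + b) \<and>
    (\<forall>j\<le>k. \<forall>x. \<bar>(deriv ^^ j) (\<lambda>x. R 0 x - R_b R0 0 x) x\<bar> \<le> a) \<and>
    (\<forall>j\<le>k-1. \<forall>x. \<bar>(deriv ^^ j) (\<lambda>x. dt R 0 x - dt (R_b R0) 0 x) x\<bar> \<le> b)"
proof -
  define X where "X = C_k_norm k (\<lambda>x. R 0 x - R_b R0 0 x)"
  define Y where "Y = C_k_norm (k - 1) (\<lambda>x. dt R 0 x - dt (R_b R0) 0 x)"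
  have XY: "m_norm R0 R k 0 = X + Y" by (simp add: m_norm_eq X_def Y_def)
  have nonneg: "X \<ge> 0" "Y \<ge> 0" by (simp_all add: X_def Y_def C_k_norm_nonneg)
  then obtain a b where ab: "X = ereal a" "Y = ereal b"
    using assms XY by (cases X; cases Y) auto
  have "X \<le> ereal a" "Y \<le> ereal b" using ab by simp_all
  then have "\<forall>j\<le>k. \<forall>x. \<bar>(deriv ^^ j) (\<lambda>x. R 0 x - R_b R0 0 x) x\<bar> \<le> a"
    "\<forall>j\<le>k-1. \<forall>x. \<bar>(deriv ^^ j) (\<lambda>x. dt R 0 x - dt (R_b R0) 0 x) x\<bar> \<le> b"
    unfolding X_def Y_def C_k_norm_le_iff by blast+
  moreover have "a \<ge> 0" "b \<ge> 0" "m_norm R0 R k 0 = ereal (a + b)"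
    using XY ab nonneg by auto
  ultimately show ?thesis by blast
qed

section \<open>Estimates for solutions close to the background\<close>

lemma ereal_mult_infty_pos: "0 < r \<Longrightarrow> ereal r * \<infinity> = \<infinity>"
  by simp

lemma perturbation_derivs:
  assumes R: "wave_solution R" and "t \<ge> 0"
  shows "dt (\<lambda>t x. R t x - R_b R0 t x) t x = dt R t x - dt (R_b R0) t x"
    "dx (\<lambda>t x. R t x - R_b R0 t x) t x = dx R t x - dx (R_b R0) t x"
proof -
  have "C_k (Suc 1) R" using R by (simp add: wave_solution_def numeral_2_eq_2)
  note R1 = C_k_SucD(2,3)[OF this assms(2)]
  show "dt (\<lambda>t x. R t x - R_b R0 t x) t x = dt R t x - dt (R_b R0) t x"
    unfolding dt_R_b[OF assms(2)] R_b_def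
    by (intro dt_eqI[OF assms(2)] DERIV_diff R1 R_b_derivs)
  show "dx (\<lambda>t x. R t x - R_b R0 t x) t x = dx R t x - dx (R_b R0) t x"
    unfolding dx_R_b R_b_def
    by (intro dx_eqI DERIV_diff R1 R_b_derivs)
qed

text \<open>
  A derivative of positive order factors through \<open>dx\<close> if it contains an \<open>x\<close>-derivative, and through
  \<open>dt\<close> otherwise.
\<close>

lemma partial_bounded_of_dt_dx:
  assumes "deriv_bounded L k s W (dt u)" "deriv_bounded L k s W (dx u)"
    and "mi_order \<alpha> = Suc k" "t \<ge> 0"
  shows "\<bar>partial \<alpha> u t x\<bar> \<le> s * L ^ k * W t x"
proof (cases "snd \<alpha>")
  case 0
  then have "fst \<alpha> = Suc k" using assms(3) by (simp add: mi_order_def)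
  then have "partial \<alpha> u = partial (k, 0) (dt u)"
    using 0 by (simp add: partial_def funpow_Suc_right del: funpow.simps(2))
  then show ?thesis
    using deriv_bounded_partial[of L "(k, 0)" s W "dt u" t x] assms by (simp add: mi_order_def)
next
  case (Suc n)
  then have k: "fst \<alpha> + n = k" using assms(3) by (simp add: mi_order_def)
  have "partial \<alpha> u = partial (fst \<alpha>, n) (dx u)"
    using Suc by (simp add: partial_def funpow_Suc_right del: funpow.simps(2))
  then show ?thesis
    using deriv_bounded_partial[of L "(fst \<alpha>, n)" s W "dx u" t x] assms k by (simp add: mi_order_def)
qed

lemma small_perturbation:
  assumes "R0 > 0" and R: "wave_solution R" and small: "m_norm R0 R 0 0 < ereal (2 * R0 / 3)"
  shows "\<exists>a\<ge>0. \<exists>b\<ge>0. m_norm R0 R 0 0 = ereal (a + b) \<and> a + b < 2 * R0 / 3 \<and>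
    (\<forall>x. \<bar>R 0 x - R_b R0 0 x\<bar> \<le> a) \<and> (\<forall>x. \<bar>dt R 0 x - dt (R_b R0) 0 x\<bar> \<le> b) \<and>
    (\<forall>t\<ge>0. \<forall>x. \<bar>R t x - R_b R0 t x\<bar> \<le> a + t * b) \<and>
    (\<forall>t\<ge>0. \<forall>x. R t x \<ge> R0 / 3 * (exp (2 * t) * cosh (2 * x)))"
proof -
  have "m_norm R0 R 0 0 \<noteq> \<infinity>" using small by auto
  from m_norm_finite[OF this] obtain a b where m: "m_norm R0 R 0 0 = ereal (a + b)" and ab: "a \<ge> 0" "b \<ge> 0"
    and h: "\<forall>j\<le>0. \<forall>x. \<bar>(deriv ^^ j) (\<lambda>x. R 0 x - R_b R0 0 x) x\<bar> \<le> a"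
      "\<forall>j\<le>0-1. \<forall>x. \<bar>(deriv ^^ j) (\<lambda>x. dt R 0 x - dt (R_b R0) 0 x) x\<bar> \<le> b"
    by blast
  have h0: "\<bar>R 0 x - R_b R0 0 x\<bar> \<le> a" and h1: "\<bar>dt R 0 x - dt (R_b R0) 0 x\<bar> \<le> b" for x
    using h by auto
  have lt: "a + b < 2 * R0 / 3" using small m by simp
  have le: "\<bar>R t x - R_b R0 t x\<bar> \<le> a + t * b" if "t \<ge> 0" for t x
    using dalembert_wave_bound[OF dalembert_wave_perturbation[OF R] h0 h1 that] .
  have "R t x \<ge> R0 / 3 * (exp (2 * t) * cosh (2 * x))" if "t \<ge> 0" for t x
    using perturbed_background_pos[OF assms(1) less_imp_le[OF lt] ab that le[OF that], of x x] by simp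
  then show ?thesis using m ab lt h0 h1 le by blast
qed

text \<open>
  The scale \<open>L = 1\<close> is used here: all derivatives of the profiles have one and the same bound, the
  norm of the data.
\<close>

lemma partial_perturbation_le:
  assumes R: "wave_solution R" and \<alpha>: "mi_order \<alpha> = Suc k" and Ck: "C_k (Suc k) R" and "t \<ge> 0"
  shows "sup_norm (partial \<alpha> (\<lambda>t x. R t x - R_b R0 t x) t) \<le> m_norm R0 R (Suc k) 0"
proof (cases "m_norm R0 R (Suc k) 0 = \<infinity>")
  case False
  from m_norm_finite[OF False] obtain a b where m: "m_norm R0 R (Suc k) 0 = ereal (a + b)"
    and h: "\<forall>j\<le>Suc k. \<forall>x. \<bar>(deriv ^^ j) (\<lambda>x. R 0 x - R_b R0 0 x) x\<bar> \<le> a"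
      "\<forall>j\<le>Suc k - 1. \<forall>x. \<bar>(deriv ^^ j) (\<lambda>x. dt R 0 x - dt (R_b R0) 0 x) x\<bar> \<le> b"
    by blast
  have h0: "\<bar>(deriv ^^ Suc j) (\<lambda>x. R 0 x - R_b R0 0 x) y\<bar> \<le> a * 1 ^ j" if "j \<le> k" for j y
    using h(1)[rule_format, of "Suc j" y] that by simp
  have h1: "\<bar>(deriv ^^ j) (\<lambda>x. dt R 0 x - dt (R_b R0) 0 x) y\<bar> \<le> b * 1 ^ j" if "j \<le> k" for j y
    using h(2)[rule_format, of j y] that by simp
  note B = dalembert_wave_dt_dx_bounded[OF dalembert_wave_perturbation[OF R]
      perturbation_data_times_diff[OF Ck] h0 h1 zero_le_one]
  have "\<bar>partial \<alpha> (\<lambda>t x. R t x - R_b R0 t x) t x\<bar> \<le> (a + b) * 1 ^ k * 1" for x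
    by (rule partial_bounded_of_dt_dx[OF B \<alpha> \<open>t \<ge> 0\<close>])
  then show ?thesis unfolding sup_norm_def m by (intro SUP_least) simp
qed (simp del: m_norm.simps)

text \<open>
  The derivatives of the quotients are sums of products of derivatives of \<open>u\<close>, divided by powers
  of \<open>R\<close>.  At the scale and size provided by \<open>interpolated_data\<close> such a product of total order
  \<open>k\<close> is of size \<open>S L\<^sup>k\<close>, which is at most the norm of order \<open>k + 1\<close>; so the bound is linear
  in that norm although the expression is not linear in \<open>u\<close>.
\<close>

lemma partial_quotient_le:
  assumes "R0 > 0"
  shows "\<exists>C>0. \<forall>R. wave_solution R \<and> m_norm R0 R 0 0 < ereal (2 * R0 / 3) \<longrightarrow> C_k (mi_order \<alpha> + 1) R \<longrightarrow>
    (\<forall>t\<ge>0. \<forall>x.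
       ereal \<bar>partial \<alpha> (\<lambda>t x. dt R t x / R t x - dt (R_b R0) t x / R_b R0 t x) t x\<bar>
         \<le> ereal (C * ((t + 1) / (exp (2 * t) * cosh (2 * x)))) * m_norm R0 R (mi_order \<alpha> + 1) 0 \<and>
       ereal \<bar>partial \<alpha> (\<lambda>t x. dx R t x / R t x - dx (R_b R0) t x / R_b R0 t x) t x\<bar>
         \<le> ereal (C * ((t + 1) / (exp (2 * t) * cosh (2 * x)))) * m_norm R0 R (mi_order \<alpha> + 1) 0)"
proof -
  define k where "k = mi_order \<alpha>"
  define A where "A = 2 * R0 / 3"
  have A: "A \<ge> 0" using assms by (simp add: A_def)
  obtain c where c: "c \<ge> 1" and data: "\<forall>h0 h1 M. times_diff (Suc k) h0 \<longrightarrow> times_diff k h1 \<longrightarrow>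
    (\<forall>y. \<bar>h0 y\<bar> \<le> A) \<longrightarrow> (\<forall>y. \<bar>h1 y\<bar> \<le> A) \<longrightarrow>
    (\<forall>j\<le>Suc k. \<forall>y. \<bar>(deriv ^^ j) h0 y\<bar> \<le> M) \<longrightarrow> (\<forall>j\<le>k. \<forall>y. \<bar>(deriv ^^ j) h1 y\<bar> \<le> M) \<longrightarrow>
    (\<exists>L\<ge>1. \<exists>S\<ge>0. S \<le> L \<and> S * L ^ k \<le> M \<and> (\<forall>y. \<bar>h0 y\<bar> \<le> c * S) \<and>
      (\<forall>j\<le>k. \<forall>y. \<bar>(deriv ^^ Suc j) h0 y\<bar> \<le> c * S * L ^ j \<and> \<bar>(deriv ^^ j) h1 y\<bar> \<le> c * S * L ^ j))"
    using interpolated_data[OF A, of k] by blast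
  \<comment> \<open>\<open>2 c\<close> covers the sum of the bounds for \<open>h0\<close> and \<open>h1\<close>, and \<open>A\<close> the bound on \<open>u\<close> without \<open>S\<close>\<close>
  define d where "d = 2 * c + A"
  have d: "d \<ge> 0" using c A by (simp add: d_def)
  obtain C where C: "C > 0" and quot: "\<forall>L\<ge>1. \<forall>S\<ge>0. \<forall>u f b.
    deriv_bounded L k d (\<lambda>t _. 1 + t) u \<longrightarrow>
    deriv_bounded L k (d * S) (\<lambda>t _. 1 + t) u \<longrightarrow>
    deriv_bounded L k (d * S) (\<lambda>t _. 1 + t) f \<longrightarrow>
    deriv_bounded L k (2 * R0 * 2 ^ k) (\<lambda>t x. exp (2 * t) * cosh (2 * x)) b \<longrightarrow>
    (\<forall>t\<ge>0. \<forall>x. R_b R0 t x + u t x \<ge> R0 / 3 * (exp (2 * t) * cosh (2 * x))) \<longrightarrow>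
    deriv_bounded L k (C * S) (\<lambda>t x. (1 + t) / (exp (2 * t) * cosh (2 * x)))
      (\<lambda>t x. f t x * (1 / (R_b R0 t x + u t x)) +
        (-1) * (b t x * (1 / R_b R0 t x) * u t x * (1 / (R_b R0 t x + u t x))))"
    using quotient_remainder_bounded[OF assms d, of "2 * R0 * 2 ^ k" k] assms by auto
  have main: "ereal \<bar>partial \<alpha> (\<lambda>t x. dt R t x / R t x - dt (R_b R0) t x / R_b R0 t x) t x\<bar>
         \<le> ereal (C * ((t + 1) / (exp (2 * t) * cosh (2 * x)))) * m_norm R0 R (Suc k) 0 \<and>
       ereal \<bar>partial \<alpha> (\<lambda>t x. dx R t x / R t x - dx (R_b R0) t x / R_b R0 t x) t x\<bar>
         \<le> ereal (C * ((t + 1) / (exp (2 * t) * cosh (2 * x)))) * m_norm R0 R (Suc k) 0"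
    if R: "wave_solution R" and small: "m_norm R0 R 0 0 < ereal (2 * R0 / 3)"
      and Ck: "C_k (Suc k) R" and t: "t \<ge> 0" for R t x
  proof (cases "m_norm R0 R (Suc k) 0 = \<infinity>")
    case True
    \<comment> \<open>an infinite norm makes the right-hand sides infinite, because \<open>C\<close> is positive\<close>
    have "C * ((t + 1) / (exp (2 * t) * cosh (2 * x))) > 0"
      using C t by (intro mult_pos_pos divide_pos_pos) (auto simp: cosh_real_pos)
    then show ?thesis unfolding True by (simp only: ereal_mult_infty_pos simp_thms ereal_less_eq(1))
  next
    case False
    define u where "u = (\<lambda>t x. R t x - R_b R0 t x)"
    define h0 where "h0 = (\<lambda>x. R 0 x - R_b R0 0 x)"
    define h1 where "h1 = (\<lambda>x. dt R 0 x - dt (R_b R0) 0 x)"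
    have u: "dalembert_wave h0 h1 u"
      unfolding u_def h0_def h1_def by (rule dalembert_wave_perturbation[OF R])
    have diff: "times_diff (Suc k) h0" "times_diff k h1"
      unfolding h0_def h1_def by (rule perturbation_data_times_diff[OF Ck])+
    from small_perturbation[OF assms R small] obtain a0 b0 where
      s: "a0 \<ge> 0" "b0 \<ge> 0" "a0 + b0 < 2 * R0 / 3"
      "\<forall>x. \<bar>R 0 x - R_b R0 0 x\<bar> \<le> a0" "\<forall>x. \<bar>dt R 0 x - dt (R_b R0) 0 x\<bar> \<le> b0"
      "\<forall>t\<ge>0. \<forall>x. \<bar>R t x - R_b R0 t x\<bar> \<le> a0 + t * b0"
      and low: "\<forall>t\<ge>0. \<forall>x. R t x \<ge> R0 / 3 * (exp (2 * t) * cosh (2 * x))"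
      by blast
    have s0: "a0 \<ge> 0" "b0 \<ge> 0" "a0 + b0 < A" "\<And>x. \<bar>h0 x\<bar> \<le> a0" "\<And>x. \<bar>h1 x\<bar> \<le> b0"
      "\<And>t x. t \<ge> 0 \<Longrightarrow> \<bar>u t x\<bar> \<le> a0 + t * b0"
      using s[rule_format] by (simp_all only: h0_def h1_def u_def A_def)
    from m_norm_finite[OF False, folded h0_def h1_def] obtain a b
      where m: "m_norm R0 R (Suc k) 0 = ereal (a + b)" and ab: "a \<ge> 0" "b \<ge> 0"
      and h: "\<forall>j\<le>Suc k. \<forall>x. \<bar>(deriv ^^ j) h0 x\<bar> \<le> a" "\<forall>j\<le>Suc k - 1. \<forall>x. \<bar>(deriv ^^ j) h1 x\<bar> \<le> b"
      by blast
    have "\<exists>L\<ge>1. \<exists>S\<ge>0. S \<le> L \<and> S * L ^ k \<le> a + b \<and> (\<forall>y. \<bar>h0 y\<bar> \<le> c * S) \<and>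
      (\<forall>j\<le>k. \<forall>y. \<bar>(deriv ^^ Suc j) h0 y\<bar> \<le> c * S * L ^ j \<and> \<bar>(deriv ^^ j) h1 y\<bar> \<le> c * S * L ^ j)"
    proof (rule data[rule_format, OF diff])
      show "\<bar>h0 y\<bar> \<le> A" "\<bar>h1 y\<bar> \<le> A" for y using s0(1-3) s0(4)[of y] s0(5)[of y] by auto
      show "\<bar>(deriv ^^ j) h0 y\<bar> \<le> a + b" if "j \<le> Suc k" for j y using h(1)[rule_format, OF that, of y] ab by simp
      show "\<bar>(deriv ^^ j) h1 y\<bar> \<le> a + b" if "j \<le> k" for j y using h(2)[rule_format, of j y] that ab by simp
    qed
    then obtain L S where L: "L \<ge> 1" and S: "S \<ge> 0" "S \<le> L" "S * L ^ k \<le> a + b"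
      and h0_le: "\<And>y. \<bar>h0 y\<bar> \<le> c * S"
      and hS: "\<And>j y. j \<le> k \<Longrightarrow> \<bar>(deriv ^^ Suc j) h0 y\<bar> \<le> c * S * L ^ j"
        "\<And>j y. j \<le> k \<Longrightarrow> \<bar>(deriv ^^ j) h1 y\<bar> \<le> c * S * L ^ j"
      by blast
    have h1_le: "\<bar>h1 y\<bar> \<le> c * S" for y using hS(2)[of 0 y] by simp
    have L0: "L \<ge> 0" using L by simp
    have cS: "c * S + c * S \<le> d * S" "d * S \<ge> 0" "c * S \<le> d * S"
      using S(1) A d c by (auto simp: d_def distrib_right)
    have uS: "\<bar>u t x\<bar> \<le> d * S * (1 + t)" if "t \<ge> 0" for t x
      using dalembert_wave_bound[OF u h0_le h1_le that, of x] mult_left_mono[OF cS(3), of "1 + t"] that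
      by (simp add: algebra_simps)
    have u1: "\<bar>u t x\<bar> \<le> d * (1 + t)" if "t \<ge> 0" for t x
    proof -
      have "a0 + t * b0 \<le> A + t * A" using s0(1-3) that by (intro add_mono mult_left_mono) auto
      also have "\<dots> \<le> d + t * d" using c A that by (intro add_mono mult_left_mono) (auto simp: d_def)
      finally show ?thesis using s0(6)[OF that, of x] by (simp add: algebra_simps)
    qed
    have du: "deriv_bounded L k (d * S) (\<lambda>_ _. 1) (dt u)" "deriv_bounded L k (d * S) (\<lambda>_ _. 1) (dx u)"
      using dalembert_wave_dt_dx_bounded[OF u diff hS L0] cS L0
      by (auto intro: deriv_bounded_mono[OF _ order_refl])
    have bS: "deriv_bounded L k (d * S) (\<lambda>t _. 1 + t) u"
      by (rule deriv_bounded_pred, rule dalembert_wave_bounded[OF u du uS])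
         (use cS(2) L L0 mult_left_mono[OF L cS(2)] in auto)
    have b1: "deriv_bounded L k d (\<lambda>t _. 1 + t) u"
      by (rule deriv_bounded_pred, rule dalembert_wave_bounded[OF u du u1])
         (use d L0 mult_left_mono[OF S(2) d] in auto)
    have fS: "deriv_bounded L k (d * S) (\<lambda>t _. 1 + t) (dt u)" "deriv_bounded L k (d * S) (\<lambda>t _. 1 + t) (dx u)"
      by (rule deriv_bounded_mono[OF du(1)] deriv_bounded_mono[OF du(2)]; use cS L0 in simp)+
    have R_eq: "R_b R0 t x + u t x = R t x" for t x by (simp add: u_def)
    have low': "\<forall>t\<ge>0. \<forall>x. R_b R0 t x + u t x \<ge> R0 / 3 * (exp (2 * t) * cosh (2 * x))"
      using low by (simp only: R_eq)
    have bg: "deriv_bounded L k (2 * R0 * 2 ^ k) (\<lambda>t x. exp (2 * t) * cosh (2 * x)) (dt (R_b R0))"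
      "deriv_bounded L k (2 * R0 * 2 ^ k) (\<lambda>t x. exp (2 * t) * cosh (2 * x)) (dx (R_b R0))"
      using deriv_bounded_cong[OF R_b_deriv_bounded(1)[OF L, of k "2 * R0"], of "dt (R_b R0)"]
        deriv_bounded_cong[OF R_b_deriv_bounded(2)[OF L, of k "2 * R0"], of "dx (R_b R0)"] assms
      by (simp_all add: dt_R_b dx_R_b)
    have "R0 / 3 * (exp (2 * t) * cosh (2 * x)) > 0" for t x
      using assms by (simp add: cosh_real_pos)
    then have R_pos: "R t x > 0" if "t \<ge> 0" for t x using low[rule_format, OF that, of x] by (meson less_le_trans)
    have Rb_pos: "R_b R0 t x > 0" for t x using assms by (simp add: R_b_def cosh_real_pos)
    have frac_split: "f * (1 / r) + (-1) * (g * (1 / rb) * v * (1 / r)) = (f + g) / r - g / rb"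
      if "r = rb + v" "r > 0" "rb > 0" for f g r rb v :: real
    proof -
      have v: "v = r - rb" and "r \<noteq> 0" "rb \<noteq> 0" using that by auto
      then show ?thesis unfolding v by (simp add: field_simps)
    qed
    have du_eq: "dt u t x = dt R t x - dt (R_b R0) t x" "dx u t x = dx R t x - dx (R_b R0) t x"
      if "t \<ge> 0" for t x
      unfolding u_def by (rule perturbation_derivs[OF R that])+
    have Q: "deriv_bounded L k (C * S) (\<lambda>t x. (1 + t) / (exp (2 * t) * cosh (2 * x)))
        (\<lambda>t x. dt R t x / R t x - dt (R_b R0) t x / R_b R0 t x)"
      "deriv_bounded L k (C * S) (\<lambda>t x. (1 + t) / (exp (2 * t) * cosh (2 * x)))
        (\<lambda>t x. dx R t x / R t x - dx (R_b R0) t x / R_b R0 t x)"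
    proof -
      have eqs: "dt u t x * (1 / (R_b R0 t x + u t x)) +
          (-1) * (dt (R_b R0) t x * (1 / R_b R0 t x) * u t x * (1 / (R_b R0 t x + u t x))) =
          dt R t x / R t x - dt (R_b R0) t x / R_b R0 t x"
        "dx u t x * (1 / (R_b R0 t x + u t x)) +
          (-1) * (dx (R_b R0) t x * (1 / R_b R0 t x) * u t x * (1 / (R_b R0 t x + u t x))) =
          dx R t x / R t x - dx (R_b R0) t x / R_b R0 t x" if "t \<ge> 0" for t x
        unfolding R_eq
        using du_eq[OF that, of x]
          frac_split[OF R_eq[symmetric] R_pos[OF that] Rb_pos, of "dt u t x" x "dt (R_b R0) t x"]
          frac_split[OF R_eq[symmetric] R_pos[OF that] Rb_pos, of "dx u t x" x "dx (R_b R0) t x"]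
        by simp_all
      show "deriv_bounded L k (C * S) (\<lambda>t x. (1 + t) / (exp (2 * t) * cosh (2 * x)))
          (\<lambda>t x. dt R t x / R t x - dt (R_b R0) t x / R_b R0 t x)"
        by (rule deriv_bounded_cong[OF quot[rule_format, OF L S(1) b1 bS fS(1) bg(1) low'[rule_format]] eqs(1)])
      show "deriv_bounded L k (C * S) (\<lambda>t x. (1 + t) / (exp (2 * t) * cosh (2 * x)))
          (\<lambda>t x. dx R t x / R t x - dx (R_b R0) t x / R_b R0 t x)"
        by (rule deriv_bounded_cong[OF quot[rule_format, OF L S(1) b1 bS fS(2) bg(2) low'[rule_format]] eqs(2)])
    qed
    have fin: "ereal \<bar>partial \<alpha> g t x\<bar> \<le> ereal (C * ((t + 1) / (exp (2 * t) * cosh (2 * x)))) * m_norm R0 R (Suc k) 0"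
      if g: "deriv_bounded L k (C * S) (\<lambda>t x. (1 + t) / (exp (2 * t) * cosh (2 * x))) g" for g
    proof -
      have "\<bar>partial \<alpha> g t x\<bar> \<le> C * S * L ^ k * ((1 + t) / (exp (2 * t) * cosh (2 * x)))"
        using deriv_bounded_partial[of L \<alpha> _ _ g, folded k_def, OF g t] .
      also have "\<dots> = C * ((1 + t) / (exp (2 * t) * cosh (2 * x))) * (S * L ^ k)" by simp
      also have "\<dots> \<le> C * ((1 + t) / (exp (2 * t) * cosh (2 * x))) * (a + b)"
        using C t by (intro mult_left_mono[OF S(3)] mult_nonneg_nonneg divide_nonneg_nonneg)
          (auto simp: cosh_real_nonneg)
      finally show ?thesis unfolding m by (simp add: add.commute)
    qed
    show ?thesis using fin[OF Q(1)] fin[OF Q(2)] by blast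
  qed
  show ?thesis
    using C main unfolding k_def Suc_eq_plus1 by (intro exI[where x=C]) blast
qed

theorem theorem3p2:
  fixes R0 :: real
  assumes "R0 > 0"
  shows
    "(\<forall>R. wave_solution R \<and> m_norm R0 R 0 0 < ereal (2 * R0 / 3) \<longrightarrow>
        (\<forall>t\<ge>0. \<forall>x. R t x > 0) \<and>
        (\<forall>t\<ge>0. sup_norm (\<lambda>x. R t x - R_b R0 t x) \<le> ereal (t + 1) * m_norm R0 R 0 0)) \<and>
     (\<forall>\<alpha>. \<alpha> \<noteq> (0, 0) \<longrightarrow>
        (\<exists>C::real. \<forall>R. wave_solution R \<and> m_norm R0 R 0 0 < ereal (2 * R0 / 3) \<longrightarrow>
           (C_k (mi_order \<alpha>) R \<longrightarrow>
              (\<forall>t\<ge>0. sup_norm (partial \<alpha> (\<lambda>t x. R t x - R_b R0 t x) t) \<le> m_norm R0 R (mi_order \<alpha>) 0)) \<and>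
           (C_k (mi_order \<alpha> + 1) R \<longrightarrow>
              (\<forall>t\<ge>0. \<forall>x.
                 ereal \<bar>partial \<alpha> (\<lambda>t x. dt R t x / R t x - dt (R_b R0) t x / R_b R0 t x) t x\<bar>
                   \<le> ereal (C * ((t + 1) / (exp (2 * t) * cosh (2 * x)))) * m_norm R0 R (mi_order \<alpha> + 1) 0 \<and>
                 ereal \<bar>partial \<alpha> (\<lambda>t x. dx R t x / R t x - dx (R_b R0) t x / R_b R0 t x) t x\<bar>
                   \<le> ereal (C * ((t + 1) / (exp (2 * t) * cosh (2 * x)))) * m_norm R0 R (mi_order \<alpha> + 1) 0))))"
proof (intro conjI allI impI)
  fix R t x
  assume R: "wave_solution R \<and> m_norm R0 R 0 0 < ereal (2 * R0 / 3)" and t: "(t::real) \<ge> 0"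
  from small_perturbation[OF assms conjunct1[OF R] conjunct2[OF R]] obtain a b where
    ab: "m_norm R0 R 0 0 = ereal (a + b)" "a \<ge> 0" "b \<ge> 0"
    "\<forall>t\<ge>0. \<forall>x. \<bar>R t x - R_b R0 t x\<bar> \<le> a + t * b"
    "\<forall>t\<ge>0. \<forall>x. R t x \<ge> R0 / 3 * (exp (2 * t) * cosh (2 * x))"
    by blast
  have "0 < R0 / 3 * (exp (2 * t) * cosh (2 * x))" using assms by (simp add: cosh_real_pos)
  then show "R t x > 0" using ab(5)[rule_format, OF t, of x] by linarith
  have "\<bar>R t y - R_b R0 t y\<bar> \<le> (t + 1) * (a + b)" for y
  proof -
    have "(t + 1) * (a + b) = (a + t * b) + (b + t * a)" by (simp add: algebra_simps)
    moreover have "0 \<le> b + t * a" using ab t by simp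
    ultimately show ?thesis using ab(4)[rule_format, OF t, of y] by linarith
  qed
  then show "sup_norm (\<lambda>x. R t x - R_b R0 t x) \<le> ereal (t + 1) * m_norm R0 R 0 0"
    unfolding sup_norm_def ab(1) by (intro SUP_least) simp
next
  fix \<alpha> :: "nat \<times> nat"
  assume \<alpha>: "\<alpha> \<noteq> (0, 0)"
  then obtain k where k: "mi_order \<alpha> = Suc k"
    by (cases \<alpha>; cases "mi_order \<alpha>") (auto simp: mi_order_def)
  obtain C where C: "\<forall>R. wave_solution R \<and> m_norm R0 R 0 0 < ereal (2 * R0 / 3) \<longrightarrow> C_k (mi_order \<alpha> + 1) R \<longrightarrow>
    (\<forall>t\<ge>0. \<forall>x.
       ereal \<bar>partial \<alpha> (\<lambda>t x. dt R t x / R t x - dt (R_b R0) t x / R_b R0 t x) t x\<bar>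
         \<le> ereal (C * ((t + 1) / (exp (2 * t) * cosh (2 * x)))) * m_norm R0 R (mi_order \<alpha> + 1) 0 \<and>
       ereal \<bar>partial \<alpha> (\<lambda>t x. dx R t x / R t x - dx (R_b R0) t x / R_b R0 t x) t x\<bar>
         \<le> ereal (C * ((t + 1) / (exp (2 * t) * cosh (2 * x)))) * m_norm R0 R (mi_order \<alpha> + 1) 0)"
    using partial_quotient_le[OF assms, of \<alpha>] by blast
  show "\<exists>C::real. \<forall>R. wave_solution R \<and> m_norm R0 R 0 0 < ereal (2 * R0 / 3) \<longrightarrow>
     (C_k (mi_order \<alpha>) R \<longrightarrow>
        (\<forall>t\<ge>0. sup_norm (partial \<alpha> (\<lambda>t x. R t x - R_b R0 t x) t) \<le> m_norm R0 R (mi_order \<alpha>) 0)) \<and>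
     (C_k (mi_order \<alpha> + 1) R \<longrightarrow>
        (\<forall>t\<ge>0. \<forall>x.
           ereal \<bar>partial \<alpha> (\<lambda>t x. dt R t x / R t x - dt (R_b R0) t x / R_b R0 t x) t x\<bar>
             \<le> ereal (C * ((t + 1) / (exp (2 * t) * cosh (2 * x)))) * m_norm R0 R (mi_order \<alpha> + 1) 0 \<and>
           ereal \<bar>partial \<alpha> (\<lambda>t x. dx R t x / R t x - dx (R_b R0) t x / R_b R0 t x) t x\<bar>
             \<le> ereal (C * ((t + 1) / (exp (2 * t) * cosh (2 * x)))) * m_norm R0 R (mi_order \<alpha> + 1) 0))"
  proof (intro exI[of _ C] allI impI conjI)
    fix R t
    assume "wave_solution R \<and> m_norm R0 R 0 0 < ereal (2 * R0 / 3)" "C_k (mi_order \<alpha>) R" "(t::real) \<ge> 0"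
    then show "sup_norm (partial \<alpha> (\<lambda>t x. R t x - R_b R0 t x) t) \<le> m_norm R0 R (mi_order \<alpha>) 0"
      using partial_perturbation_le[OF _ k] unfolding k by blast
  qed (use C in blast)+
qed

end
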